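(* Let $f_0:\mathbb{R}^{p+1}\to\mathbb{A}$ be a polynomial. Then $$CK[f_0](\mathbf{x})=\sum_{k\ge0}\frac{r^{2k}}{(2k)!}(-\Delta_{\mathbf{x}_p})^kf_0(\mathbf{x}_p)+\underline{\omega}\sum_{k\ge0}\frac{r^{2k+1}}{(2k+1)!}(-\Delta_{\mathbf{x}_p})^k\big(D_{\mathbf{x}_p}f_0(\mathbf{x}_p)\big),\quad \mathbf{x}=\mathbf{x}_p+r\underline{\omega}\in M,$$ (a finite sum) is the unique extension of $f_0$ to $M$ which is (left) generalized partial-slice monogenic of type $(p,q)$.
   Context: Let $\mathbb{A}$ be a real alternative algebra (the associator $[a,b,c]=(ab)c-a(bc)$ is an alternating trilinear function) with unity $1$, of finite real dimension $d>1$, equipped with an anti-involution $a\mapsto a^c$ (real linear, $a^c=a$ for real $a$, $(a^c)^c=a$, $(ab)^c=b^ca^c$). Let $t(x)=x+x^c$, $n(x)=xx^c$, $\mathbb{S}_{\mathbb{A}}=\{x: t(x)=0,\ n(x)=1\}$ (assumed nonempty) and $Q_{\mathbb{A}}=\mathbb{R}\cup\{x: t(x)\in\mathbb{R},\ n(x)\in\mathbb{R},\ 4n(x)>t(x)^2\}$. Let $M$ be a real subspace with $\mathbb{R}\subsetneq M\subseteq Q_{\mathbb{A}}$ having a basis $(v_0,\dots,v_m)$, $m\ge1$, $v_0=1$, $v_s\in\mathbb{S}_{\mathbb{A}}$, $v_sv_t=-v_tv_s$ for distinct $s,t\ge1$; complete it to a basis of $\mathbb{A}$ with associated Euclidean norm.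 Identify $x=\sum x_sv_s\in M$ with $(x_0,\dots,x_m)\in\mathbb{R}^{m+1}$; differentiate componentwise. Fix $p\in\{0,\dots,m-1\}$, $q=m-p$; $\mathbf{x}=\mathbf{x}_p+\underline{\mathbf{x}}_q$ with $\mathbf{x}_p=\sum_{s=0}^px_sv_s\in\mathbb{R}^{p+1}$, $\underline{\mathbf{x}}_q=\sum_{s=p+1}^m x_sv_s$; $\mathbb{S}=\{\sum_{s=p+1}^m x_sv_s:\sum x_s^2=1\}$; $\underline{\mathbf{x}}_q=r\underline{\omega}$ with $r=|\underline{\mathbf{x}}_q|$, $\underline{\omega}\in\mathbb{S}$. $D_{\mathbf{x}_p}f=\sum_{s=0}^p v_s\partial_{x_s}f$, $\Delta_{\mathbf{x}_p}=\sum_{s=0}^p\partial_{x_s}^2$. A function $f:\Omega\to\mathbb{A}$ ($\Omega\subseteq M$ open) is left generalized partial-slice monogenic of type $(p,q)$ if for every $\underline{\omega}\in\mathbb{S}$ its restriction to $\Omega\cap(\mathbb{R}^{p+1}\oplus\underline{\omega}\mathbb{R})$ is $C^1$ and satisfies $(D_{\mathbf{x}_p}+\underline{\omega}\partial_r)f(\mathbf{x}_p+r\underline{\omega})=0$. *)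

theory Defs
  imports "HOL-Analysis.Analysis"
begin

text \<open>The real algebra A is modelled as a Euclidean space 'a (finite real dimension,
  its topology agrees with the one of any Euclidean norm) with an explicit bilinear
  (possibly non-associative) multiplication mul, unity e and conjugation cj.\<close>

definition associator :: "('a \<Rightarrow> 'a \<Rightarrow> 'a::real_vector) \<Rightarrow> 'a \<Rightarrow> 'a \<Rightarrow> 'a \<Rightarrow> 'a" where
  "associator mul a b c = mul (mul a b) c - mul a (mul b c)"

definition alt_star_algebra ::
  "('a::euclidean_space \<Rightarrow> 'a \<Rightarrow> 'a) \<Rightarrow> 'a \<Rightarrow> ('a \<Rightarrow> 'a) \<Rightarrow> bool" where
  "alt_star_algebra mul e cj \<longleftrightarrow>
     bilinear mul \<and>
     (\<forall>a. mul e a = a \<and> mul a e = a) \<and>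
     (\<forall>a b. associator mul a a b = 0 \<and> associator mul a b a = 0 \<and> associator mul b a a = 0) \<and>
     linear cj \<and>
     (\<forall>r. cj (r *\<^sub>R e) = r *\<^sub>R e) \<and>
     (\<forall>a. cj (cj a) = a) \<and>
     (\<forall>a b. cj (mul a b) = mul (cj b) (cj a))"

definition is_real_elt :: "'a::real_vector \<Rightarrow> 'a \<Rightarrow> bool" where
  "is_real_elt e x \<longleftrightarrow> (\<exists>a. x = a *\<^sub>R e)"

definition trace_alg :: "('a \<Rightarrow> 'a) \<Rightarrow> 'a::real_vector \<Rightarrow> 'a" where
  "trace_alg cj x = x + cj x"

definition norm_alg :: "('a \<Rightarrow> 'a \<Rightarrow> 'a) \<Rightarrow> ('a \<Rightarrow> 'a) \<Rightarrow> 'a \<Rightarrow> 'a" where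
  "norm_alg mul cj x = mul x (cj x)"

definition sphere_alg :: "('a \<Rightarrow> 'a \<Rightarrow> 'a) \<Rightarrow> 'a::real_vector \<Rightarrow> ('a \<Rightarrow> 'a) \<Rightarrow> 'a set" where
  "sphere_alg mul e cj = {x. trace_alg cj x = 0 \<and> norm_alg mul cj x = e}"

definition quadratic_cone :: "('a \<Rightarrow> 'a \<Rightarrow> 'a) \<Rightarrow> 'a::real_vector \<Rightarrow> ('a \<Rightarrow> 'a) \<Rightarrow> 'a set" where
  "quadratic_cone mul e cj =
     {x. is_real_elt e x} \<union>
     {x. \<exists>a b. trace_alg cj x = a *\<^sub>R e \<and> norm_alg mul cj x = b *\<^sub>R e \<and> 4 * b > a\<^sup>2}"

definition admissible_basis ::
  "('a \<Rightarrow> 'a \<Rightarrow> 'a) \<Rightarrow> 'a::real_vector \<Rightarrow> ('a \<Rightarrow> 'a) \<Rightarrow> (nat \<Rightarrow> 'a) \<Rightarrow> nat \<Rightarrow> bool" where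
  "admissible_basis mul e cj v m \<longleftrightarrow>
     1 \<le> m \<and> v 0 = e \<and>
     (\<forall>s\<in>{1..m}. v s \<in> sphere_alg mul e cj) \<and>
     (\<forall>s\<in>{1..m}. \<forall>t\<in>{1..m}. s \<noteq> t \<longrightarrow> mul (v s) (v t) = - mul (v t) (v s)) \<and>
     (\<forall>c. (\<Sum>s\<le>m. c s *\<^sub>R v s) = 0 \<longrightarrow> (\<forall>s\<le>m. c s = 0)) \<and>
     span (v ` {..m}) \<subseteq> quadratic_cone mul e cj"

definition slice_sphere :: "(nat \<Rightarrow> 'a::real_vector) \<Rightarrow> nat \<Rightarrow> nat \<Rightarrow> 'a set" where
  "slice_sphere v p m =
     {(\<Sum>s\<in>{p+1..m}. y s *\<^sub>R v s) | y. (\<Sum>s\<in>{p+1..m}. (y s)\<^sup>2) = 1}"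

definition slice :: "(nat \<Rightarrow> 'a::real_vector) \<Rightarrow> nat \<Rightarrow> 'a \<Rightarrow> 'a set" where
  "slice v p \<omega> = {(\<Sum>s\<le>p. y s *\<^sub>R v s) + r *\<^sub>R \<omega> | y r. True}"

text \<open>Left generalized partial-slice monogenic of type (p, m-p) on Omega = M:
  on each slice the restriction is C^1 (differentiable within the slice, with continuous
  partial derivatives D z (v s) = d/dx_s and D z omega = d/dr), and
  (D_{x_p} + omega d/dr) F = 0 there.\<close>
definition gps_monogenic ::
  "('a::euclidean_space \<Rightarrow> 'a \<Rightarrow> 'a) \<Rightarrow> (nat \<Rightarrow> 'a) \<Rightarrow> nat \<Rightarrow> nat \<Rightarrow> ('a \<Rightarrow> 'a) \<Rightarrow> bool" where
  "gps_monogenic mul v p m F \<longleftrightarrow>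
     (\<forall>\<omega>\<in>slice_sphere v p m. \<exists>D.
        (\<forall>z\<in>slice v p \<omega>. (F has_derivative D z) (at z within slice v p \<omega>)) \<and>
        (\<forall>s\<le>p. continuous_on (slice v p \<omega>) (\<lambda>z. D z (v s))) \<and>
        continuous_on (slice v p \<omega>) (\<lambda>z. D z \<omega>) \<and>
        (\<forall>z\<in>slice v p \<omega>. (\<Sum>s\<le>p. mul (v s) (D z (v s))) + mul \<omega> (D z \<omega>) = 0))"

definition is_poly :: "nat \<Rightarrow> ((nat \<Rightarrow> real) \<Rightarrow> 'a::real_vector) \<Rightarrow> bool" where
  "is_poly p f \<longleftrightarrow> (\<exists>I c. finite I \<and>
      (\<forall>x. f x = (\<Sum>\<alpha>\<in>I. (\<Prod>s\<le>p. x s ^ \<alpha> s) *\<^sub>R c \<alpha>)))"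

definition pdiff :: "nat \<Rightarrow> ((nat \<Rightarrow> real) \<Rightarrow> 'a::real_normed_vector) \<Rightarrow> (nat \<Rightarrow> real) \<Rightarrow> 'a" where
  "pdiff s g x = vector_derivative (\<lambda>t. g (x(s := t))) (at (x s))"

definition lap :: "nat \<Rightarrow> ((nat \<Rightarrow> real) \<Rightarrow> 'a::real_normed_vector) \<Rightarrow> (nat \<Rightarrow> real) \<Rightarrow> 'a" where
  "lap p g x = (\<Sum>s\<le>p. pdiff s (pdiff s g) x)"

definition dirac ::
  "('a \<Rightarrow> 'a \<Rightarrow> 'a) \<Rightarrow> (nat \<Rightarrow> 'a::real_normed_vector) \<Rightarrow> nat \<Rightarrow> ((nat \<Rightarrow> real) \<Rightarrow> 'a) \<Rightarrow> (nat \<Rightarrow> real) \<Rightarrow> 'a" where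
  "dirac mul v p g x = (\<Sum>s\<le>p. mul (v s) (pdiff s g x))"

definition neg_lap_pow :: "nat \<Rightarrow> nat \<Rightarrow> ((nat \<Rightarrow> real) \<Rightarrow> 'a::real_normed_vector) \<Rightarrow> (nat \<Rightarrow> real) \<Rightarrow> 'a" where
  "neg_lap_pow p k g = ((\<lambda>h x. - lap p h x) ^^ k) g"

text \<open>Cauchy-Kovalevskaya extension, evaluated at the point x = sum_{s<=m} y_s v_s of M
  given by its coordinates y.  r = |x_q|, omega = x_q / r, f_0 evaluated at x_p.\<close>
definition CK ::
  "('a::euclidean_space \<Rightarrow> 'a \<Rightarrow> 'a) \<Rightarrow> (nat \<Rightarrow> 'a) \<Rightarrow> nat \<Rightarrow> nat \<Rightarrow> ((nat \<Rightarrow> real) \<Rightarrow> 'a) \<Rightarrow> (nat \<Rightarrow> real) \<Rightarrow> 'a" where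
  "CK mul v p m f0 y =
     (let yp = (\<lambda>s. if s \<le> p then y s else 0);
          r = sqrt (\<Sum>s\<in>{p+1..m}. (y s)\<^sup>2);
          \<omega> = (1 / r) *\<^sub>R (\<Sum>s\<in>{p+1..m}. y s *\<^sub>R v s)
      in (\<Sum>k. (r ^ (2*k) / fact (2*k)) *\<^sub>R neg_lap_pow p k f0 yp)
         + mul \<omega> (\<Sum>k. (r ^ (2*k+1) / fact (2*k+1)) *\<^sub>R neg_lap_pow p k (dirac mul v p f0) yp))"

end

theory Submission
  imports Defs
begin

text \<open>Existence is a computation with the finite series: the conjugate of \<open>D\<close> times \<open>D\<close> is the Laplacian, and
  the unit vector \<open>\<omega>\<close> commutes with \<open>v 0\<close> and anticommutes with the other \<open>v s\<close>.

  For uniqueness the difference of two extensions is only \<open>C\<^sup>1\<close> on each slice, so analyticity is not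
  available a priori. Its Cauchy data vanish, hence it extends by 0 to a \<open>C\<^sup>1\<close> solution \<open>U\<close> on the whole space
  that is 0 on an open half-space \<open>H\<close>. Testing the equation against radial vector fields centred at
  \<open>a \<in> H\<close> shows that \<open>U\<close> is orthogonal to every compactly supported continuous function of \<open>|z - a|\<close>. Differentiating
  in \<open>a\<close> gives the same orthogonality for \<open>z\<^sub>i U\<close>, hence for \<open>P U\<close> with any polynomial \<open>P\<close>, and
  the Weierstrass approximation theorem forces \<open>U = 0\<close>.\<close>

section \<open>Integrals of compactly supported functions\<close>

text \<open>The algebra need not be associative, so products of elements are replaced by operators
  of left multiplication: the alternative law gives these the Clifford relations on the whole
  algebra. Uniqueness is therefore proved for an abstract family of linear maps \<open>L j\<close>.

  The obstacle in uniqueness is that \<open>U\<close> cannot be differentiated twice. Both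
  derivatives are put on a radial potential instead; its Hessian is symmetric, so the factorisation
  of the Laplacian applies to the integrals of the Hessian entries against \<open>U\<close>, and
  \<open>U\<close> is orthogonal to the Laplacian of every compactly supported radial potential.
  Such Laplacians have integral 0, so they do not exhaust the radial weights: the potential of a
  general weight is singular at its centre. Since \<open>U\<close> vanishes near \<open>a\<close>,
  the potential may be altered there at no cost. This is why the centres lie in \<open>H\<close>; as
  \<open>H\<close> is open, they can still be moved in every direction.\<close>

definition cpt_cont :: "('a::euclidean_space \<Rightarrow> 'b::euclidean_space) \<Rightarrow> bool" where
  "cpt_cont F \<longleftrightarrow> continuous_on UNIV F \<and> (\<exists>B. \<forall>z. B \<le> norm z \<longrightarrow> F z = 0)"

lemma cpt_contD: "cpt_cont F \<Longrightarrow> continuous_on UNIV F"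
  by (simp add: cpt_cont_def)

lemma integral_eq_cbox:
  fixes F :: "'a::euclidean_space \<Rightarrow> 'b::euclidean_space"
  assumes "continuous_on UNIV F" "\<And>z. z \<notin> cbox a b \<Longrightarrow> F z = 0"
  shows "F integrable_on UNIV" "integral UNIV F = integral (cbox a b) F"
proof -
  have "F integrable_on cbox a b"
    by (rule integrable_continuous) (use assms(1) continuous_on_subset in blast)
  then have "(F has_integral integral (cbox a b) F) UNIV"
    by (intro has_integral_on_superset[OF integrable_integral]) (use assms(2) in auto)
  then show "F integrable_on UNIV" "integral UNIV F = integral (cbox a b) F"
    by (auto simp: integral_unique)
qed

lemma cpt_cont_cbox:
  assumes "\<And>z. B \<le> norm z \<Longrightarrow> F z = 0"
  obtains a :: "'a::euclidean_space" where "\<And>z. z \<notin> cbox (-a) a \<Longrightarrow> F z = 0"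
proof -
  obtain a where "cball (0::'a) B \<subseteq> cbox (-a) a"
    using bounded_subset_cbox_symmetric[OF bounded_cball] by blast
  then show ?thesis
    by (intro that[of a] assms) (metis linorder_le_cases mem_cball_0 subsetD)
qed

lemma cpt_cont_integrable: "cpt_cont F \<Longrightarrow> F integrable_on UNIV"
  unfolding cpt_cont_def by (metis cpt_cont_cbox integral_eq_cbox(1))

lemma cpt_cont_scaleR:
  assumes "cpt_cont \<psi>" "continuous_on UNIV F"
  shows "cpt_cont (\<lambda>z. \<psi> z *\<^sub>R F z)"
  using assms unfolding cpt_cont_def by (auto intro!: continuous_intros)

lemma cpt_cont_add:
  assumes "cpt_cont F" "cpt_cont G"
  shows "cpt_cont (\<lambda>z. F z + G z)"
proof -
  from assms obtain B C where "\<forall>z. B \<le> norm z \<longrightarrow> F z = 0" "\<forall>z. C \<le> norm z \<longrightarrow> G z = 0"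
    unfolding cpt_cont_def by blast
  then have "\<forall>z. max B C \<le> norm z \<longrightarrow> F z + G z = 0" by simp
  then have "\<exists>B. \<forall>z. B \<le> norm z \<longrightarrow> F z + G z = 0" by blast
  then show ?thesis using assms unfolding cpt_cont_def by (blast intro: continuous_on_add)
qed

lemma integral_UNIV_shift:
  fixes F :: "'a::euclidean_space \<Rightarrow> 'b::euclidean_space"
  assumes "cpt_cont F"
  shows "integral UNIV (\<lambda>z. F (z + c)) = integral UNIV F"
proof -
  from assms obtain B where B: "\<And>z. B \<le> norm z \<Longrightarrow> F z = 0" and cF: "continuous_on UNIV F"
    unfolding cpt_cont_def by blast
  obtain a where a: "\<And>z. z \<notin> cbox (-a) a \<Longrightarrow> F z = 0" using cpt_cont_cbox[of B F] B by blast
  have "integral UNIV (\<lambda>z. F (z + c)) = integral (cbox (-a - c) (a - c)) (\<lambda>z. F (z + c))"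
  proof (rule integral_eq_cbox(2))
    show "continuous_on UNIV (\<lambda>z. F (z + c))"
      by (intro continuous_on_compose2[OF cF] continuous_intros) auto
    fix z assume "z \<notin> cbox (-a - c) (a - c)"
    then have "z + c \<notin> cbox (-a) a" by (auto simp: mem_box algebra_simps)
    then show "F (z + c) = 0" by (rule a)
  qed
  also have "\<dots> = integral UNIV F"
    by (simp add: integral_shift_cbox integral_eq_cbox(2)[OF cF a])
  finally show ?thesis .
qed

text \<open>The uniform support bound moves all integrals to one box, where the Leibniz rule
  applies; the derivative of a constant at the interior parameter 0 is 0. The parameter will once
  translate the function and once move the centre of a weight.\<close>

lemma integral_derivative_eq_0:
  fixes f :: "real \<Rightarrow> 'a::euclidean_space \<Rightarrow> 'b::euclidean_space"
  assumes der: "\<And>t z. t \<in> {-1..1} \<Longrightarrow> ((\<lambda>t. f t z) has_vector_derivative f' t z) (at t)"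
    and cont: "\<And>t. t \<in> {-1..1} \<Longrightarrow> continuous_on UNIV (f t)"
    and cont': "continuous_on ({-1..1} \<times> UNIV) (\<lambda>(t, z). f' t z)"
    and supp: "\<And>t z. t \<in> {-1..1} \<Longrightarrow> B \<le> norm z \<Longrightarrow> f t z = 0"
    and supp': "\<And>z. B \<le> norm z \<Longrightarrow> f' 0 z = 0"
    and const: "\<And>t. t \<in> {-1..1} \<Longrightarrow> integral UNIV (f t) = c"
  shows "integral UNIV (f' 0) = 0"
proof -
  obtain a :: 'a where a: "cball 0 B \<subseteq> cbox (-a) a"
    using bounded_subset_cbox_symmetric[OF bounded_cball] by blast
  have out: "B \<le> norm z" if "z \<notin> cbox (-a) a" for z
    using that a by (metis linorder_le_cases mem_cball_0 subsetD)
  have "((\<lambda>t. integral (cbox (-a) a) (f t)) has_vector_derivative integral (cbox (-a) a) (f' 0))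
      (at 0 within {-1..1})"
  proof (rule leibniz_rule_vector_derivative)
    show "((\<lambda>t. f t z) has_vector_derivative f' t z) (at t within {-1..1})" if "t \<in> {-1..1}" for t z
      using der[OF that] has_vector_derivative_at_within by blast
    show "f t integrable_on cbox (-a) a" if "t \<in> {-1..1}" for t
      using cont[OF that] integrable_continuous continuous_on_subset by blast
    show "continuous_on ({-1..1} \<times> cbox (-a) a) (\<lambda>(t, z). f' t z)"
      by (rule continuous_on_subset[OF cont']) auto
  qed auto
  moreover have "integral (cbox (-a) a) (f t) = c" if "t \<in> {-1..1}" for t
    using const[OF that] integral_eq_cbox(2)[OF cont[OF that], of "-a" a] supp[OF that] out by auto
  then have "((\<lambda>t. integral (cbox (-a) a) (f t)) has_vector_derivative 0) (at 0 within {-1..1})"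
    by (intro has_vector_derivative_transform[OF _ _ has_vector_derivative_const[of c]]) auto
  ultimately have "integral (cbox (-a) a) (f' 0) = 0"
    using vector_derivative_unique_within_closed_interval[of "-1" 1 0] by fastforce
  moreover have "continuous_on UNIV (f' 0)"
  proof -
    have "continuous_on UNIV ((\<lambda>(t, z). f' t z) \<circ> (\<lambda>z. (0, z)))"
      by (intro continuous_on_compose continuous_on_subset[OF cont'] continuous_intros) auto
    then show ?thesis by (simp add: comp_def)
  qed
  ultimately show ?thesis
    using integral_eq_cbox(2)[of "f' 0" "-a" a] supp' out by auto
qed

text \<open>Translation invariance of the integral along \<open>b\<close> does the work of Fubini
  and the fundamental theorem of calculus, so \<open>b\<close> may be any vector.\<close>

lemma integral_partial_derivative_eq_0:
  fixes F :: "'a::euclidean_space \<Rightarrow> 'b::euclidean_space"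
  assumes F: "cpt_cont F" and d: "cpt_cont d"
    and der: "\<And>z. ((\<lambda>t. F (z + t *\<^sub>R b)) has_vector_derivative d z) (at 0)"
  shows "integral UNIV d = 0"
proof -
  obtain B where B: "\<And>z. B \<le> norm z \<Longrightarrow> F z = 0" using F by (auto simp: cpt_cont_def)
  obtain C where C: "\<And>z. C \<le> norm z \<Longrightarrow> d z = 0" using d by (auto simp: cpt_cont_def)
  have cF: "continuous_on UNIV F" and cd: "continuous_on UNIV d"
    using F d by (auto simp: cpt_cont_def)
  have "integral UNIV (\<lambda>z. d (z + 0 *\<^sub>R b)) = 0"
  proof (rule integral_derivative_eq_0[where f = "\<lambda>t z. F (z + t *\<^sub>R b)"
        and B = "max (B + norm b) C" and f' = "\<lambda>t z. d (z + t *\<^sub>R b)"])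
    fix t :: real and z assume t: "t \<in> {-1..1}"
    \<comment> \<open>The derivative at \<open>t\<close> is the hypothesis at 0 for the base point
      \<open>z + t *\<^sub>R b\<close>, reparametrised by \<open>s - t\<close>.\<close>
    have "((\<lambda>s. F ((z + t *\<^sub>R b) + s *\<^sub>R b)) has_vector_derivative d (z + t *\<^sub>R b)) (at (0::real))"
      by (rule der)
    then have "(((\<lambda>s. F ((z + t *\<^sub>R b) + s *\<^sub>R b)) \<circ> (\<lambda>s. s - t)) has_vector_derivative
        (1 *\<^sub>R d (z + t *\<^sub>R b))) (at t)"
      by (intro vector_diff_chain_at) (auto intro!: derivative_eq_intros)
    then show "((\<lambda>t. F (z + t *\<^sub>R b)) has_vector_derivative d (z + t *\<^sub>R b)) (at t)"
      by (simp add: comp_def algebra_simps)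
    show "F (z + t *\<^sub>R b) = 0" if "max (B + norm b) C \<le> norm z"
    proof (rule B)
      have "norm (t *\<^sub>R b) \<le> norm b" using t by (auto simp: mult_left_le_one_le)
      then show "B \<le> norm (z + t *\<^sub>R b)"
        using that norm_diff_ineq[of z "t *\<^sub>R b"] by linarith
    qed
  next
    show "continuous_on UNIV (\<lambda>z. F (z + t *\<^sub>R b))" for t
      by (intro continuous_on_compose2[OF cF] continuous_intros) auto
    show "continuous_on ({-1..1} \<times> UNIV) (\<lambda>(t, z). d (z + t *\<^sub>R b))"
      unfolding case_prod_beta by (intro continuous_on_compose2[OF cd] continuous_intros) auto
    show "integral UNIV (\<lambda>z. F (z + t *\<^sub>R b)) = integral UNIV F" for t
      by (rule integral_UNIV_shift[OF F])
  qed (use C in auto)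
  then show ?thesis by simp
qed

lemma integration_by_parts:
  fixes U :: "'a::euclidean_space \<Rightarrow> 'b::euclidean_space" and \<psi> :: "'a \<Rightarrow> real"
  assumes U: "continuous_on UNIV U" "continuous_on UNIV U'"
    and \<psi>: "cpt_cont \<psi>" "cpt_cont \<psi>'"
    and "\<And>z. ((\<lambda>t. U (z + t *\<^sub>R b)) has_vector_derivative U' z) (at 0)"
    and "\<And>z. ((\<lambda>t. \<psi> (z + t *\<^sub>R b)) has_real_derivative \<psi>' z) (at 0)"
  shows "integral UNIV (\<lambda>z. \<psi>' z *\<^sub>R U z) = - integral UNIV (\<lambda>z. \<psi> z *\<^sub>R U' z)"
proof -
  have "integral UNIV (\<lambda>z. \<psi> z *\<^sub>R U' z + \<psi>' z *\<^sub>R U z) = 0"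
  proof (rule integral_partial_derivative_eq_0[where F = "\<lambda>z. \<psi> z *\<^sub>R U z"])
    show "((\<lambda>t. \<psi> (z + t *\<^sub>R b) *\<^sub>R U (z + t *\<^sub>R b)) has_vector_derivative
        \<psi> z *\<^sub>R U' z + \<psi>' z *\<^sub>R U z) (at 0)" for z
      using has_vector_derivative_scaleR[OF assms(6)[of z] assms(5)[of z]] by simp
  qed (intro cpt_cont_add cpt_cont_scaleR assms)+
  then show ?thesis
    by (subst (asm) Henstock_Kurzweil_Integration.integral_add)
      (auto intro!: cpt_cont_integrable cpt_cont_scaleR assms simp: add_eq_0_iff)
qed

section \<open>Vanishing radial moments\<close>

text \<open>The argument will be a squared distance, which is smooth also at the centre. Taking the
  weight on the whole real line avoids an endpoint at 0 when antiderivatives are formed.\<close>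

definition radial_weight :: "(real \<Rightarrow> real) \<Rightarrow> bool" where
  "radial_weight \<kappa> \<longleftrightarrow> continuous_on UNIV \<kappa> \<and> (\<exists>R. \<forall>s\<ge>R. \<kappa> s = 0)"

text \<open>Normalising the antiderivative at \<open>R\<close>, beyond which \<kappa> vanishes,
  makes it vanish from \<open>R\<close> on. So the class of weights is closed under
  antiderivatives.\<close>

lemma radial_weight_antiderivative:
  assumes "radial_weight \<kappa>"
  obtains X where "radial_weight X" "\<And>s. (X has_real_derivative \<kappa> s) (at s)"
proof -
  from assms obtain R where c: "continuous_on UNIV \<kappa>" and R: "\<And>s. s \<ge> R \<Longrightarrow> \<kappa> s = 0"
    by (auto simp: radial_weight_def)
  obtain Y where Y: "\<And>s. (Y has_vector_derivative \<kappa> s) (at s)"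
    using einterval_antiderivative[of "-\<infinity>" "\<infinity>" \<kappa>] c by (auto simp: continuous_on_eq_continuous_at)
  define X where "X s = Y s - Y R" for s
  have der: "(X has_real_derivative \<kappa> s) (at s)" for s
    unfolding X_def using Y[of s] by (auto intro!: derivative_eq_intros simp: has_real_derivative_iff_has_vector_derivative)
  have "X s = 0" if "s \<ge> R" for s
  proof -
    have "X s = X R"
    proof (cases "s = R")
      case False
      with that have "R < s" by simp
      then show ?thesis
      proof (rule DERIV_isconst2)
        show "continuous_on {R..s} X" using der DERIV_continuous_on has_field_derivative_at_within by blast
        show "(X has_real_derivative 0) (at x)" if "R < x" for x using der[of x] R[of x] that by simp
      qed (use that in auto)
    qed simp
    then show ?thesis by (simp add: X_def)
  qed
  then have "radial_weight X"
    unfolding radial_weight_def using DERIV_continuous_on[of UNIV X \<kappa>] der by blast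
  with der that show ?thesis by blast
qed

lemma cpt_cont_radial:
  assumes "radial_weight \<kappa>"
  shows "cpt_cont (\<lambda>z::'a::euclidean_space. \<kappa> ((norm (z - a))\<^sup>2))"
proof -
  from assms obtain R where c: "continuous_on UNIV \<kappa>" and R: "\<And>s. s \<ge> R \<Longrightarrow> \<kappa> s = 0"
    by (auto simp: radial_weight_def)
  \<comment> \<open>The summand 1 makes the distance to \<open>a\<close> at least 1 as well as at
    least \<bar>R\<bar>, so that squaring preserves the bound.\<close>
  have "R \<le> (norm (z - a))\<^sup>2" if "norm a + \<bar>R\<bar> + 1 \<le> norm z" for z
  proof -
    have "\<bar>R\<bar> + 1 \<le> norm (z - a)" using that norm_triangle_ineq2[of z a] by linarith
    then have "(\<bar>R\<bar> + 1)\<^sup>2 \<le> (norm (z - a))\<^sup>2" by (intro power_mono) auto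
    moreover have "\<bar>R\<bar> + 1 \<le> (\<bar>R\<bar> + 1)\<^sup>2" by (rule self_le_power) auto
    ultimately show ?thesis by linarith
  qed
  moreover have "continuous_on UNIV (\<lambda>z. \<kappa> ((norm (z - a))\<^sup>2))"
    by (intro continuous_on_compose2[OF c] continuous_intros) auto
  ultimately show ?thesis unfolding cpt_cont_def using R by blast
qed

lemma has_real_derivative_norm_square_line:
  fixes a z b :: "'a::real_inner"
  shows "((\<lambda>t. (norm (z + t *\<^sub>R b - a))\<^sup>2) has_real_derivative 2 * ((z + t *\<^sub>R b - a) \<bullet> b)) (at t)"
proof -
  have "(norm (z + t *\<^sub>R b - a))\<^sup>2 = (z - a) \<bullet> (z - a) + 2 * t * ((z - a) \<bullet> b) + t\<^sup>2 * (b \<bullet> b)" for t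
    unfolding power2_norm_eq_inner by (simp add: inner_simps inner_commute algebra_simps power2_eq_square)
  then have eq: "(\<lambda>t. (norm (z + t *\<^sub>R b - a))\<^sup>2) =
      (\<lambda>t. (z - a) \<bullet> (z - a) + 2 * t * ((z - a) \<bullet> b) + t\<^sup>2 * (b \<bullet> b))"
    by blast
  show ?thesis unfolding eq
    by (auto intro!: derivative_eq_intros simp: inner_simps inner_commute algebra_simps)
qed

text \<open>All weights are taken at once because differentiation in the centre trades the
  antiderivative of a weight for the weight itself.\<close>

definition null_moments :: "'a::euclidean_space set \<Rightarrow> ('a \<Rightarrow> real) \<Rightarrow> bool" where
  "null_moments H w \<longleftrightarrow> continuous_on UNIV w \<and>
     (\<forall>\<kappa> a. radial_weight \<kappa> \<longrightarrow> a \<in> H \<longrightarrow> integral UNIV (\<lambda>z. \<kappa> ((norm (z - a))\<^sup>2) * w z) = 0)"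

lemma null_momentsD:
  "null_moments H w \<Longrightarrow> radial_weight \<kappa> \<Longrightarrow> a \<in> H \<Longrightarrow> integral UNIV (\<lambda>z. \<kappa> ((norm (z - a))\<^sup>2) * w z) = 0"
  "null_moments H w \<Longrightarrow> continuous_on UNIV w"
  by (auto simp: null_moments_def)

lemma radial_integrable:
  assumes "radial_weight \<kappa>" "continuous_on UNIV w"
  shows "(\<lambda>z::'a::euclidean_space. \<kappa> ((norm (z - a))\<^sup>2) * (w z :: real)) integrable_on UNIV"
  using cpt_cont_integrable[OF cpt_cont_scaleR[OF cpt_cont_radial[OF assms(1)] assms(2)]] by simp

lemma null_moments_add:
  assumes "null_moments H w" "null_moments H u"
  shows "null_moments H (\<lambda>z. w z + u z)"
  unfolding null_moments_def
proof (intro conjI allI impI)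
  show "continuous_on UNIV (\<lambda>z. w z + u z)"
    by (intro continuous_intros null_momentsD[OF assms(1)] null_momentsD[OF assms(2)])
  fix \<kappa> a assume "radial_weight \<kappa>" "a \<in> H"
  then show "integral UNIV (\<lambda>z. \<kappa> ((norm (z - a))\<^sup>2) * (w z + u z)) = 0"
    unfolding ring_distribs
    by (subst Henstock_Kurzweil_Integration.integral_add)
      (simp_all add: radial_integrable null_momentsD[OF assms(1)] null_momentsD[OF assms(2)])
qed

lemma null_moments_cmult:
  assumes "null_moments H w"
  shows "null_moments H (\<lambda>z. c * w z)"
  unfolding null_moments_def
proof (intro conjI allI impI)
  show "continuous_on UNIV (\<lambda>z. c * w z)"
    by (intro continuous_intros null_momentsD[OF assms(1)])
  fix \<kappa> a assume "radial_weight \<kappa>" "a \<in> H"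
  then show "integral UNIV (\<lambda>z. \<kappa> ((norm (z - a))\<^sup>2) * (c * w z)) = 0"
    using null_momentsD(1)[OF assms, of \<kappa> a] by (simp add: mult.left_commute)
qed

lemma null_moments_sum:
  assumes "finite I" "\<And>i. i \<in> I \<Longrightarrow> null_moments H (w i)"
  shows "null_moments H (\<lambda>z. \<Sum>i\<in>I. w i z)"
  using assms
proof (induction I rule: finite_induct)
  case empty
  show ?case by (simp add: null_moments_def)
next
  case (insert i I)
  then show ?case by (simp add: null_moments_add)
qed

text \<open>Differentiating the vanishing integral with respect to the centre of the weight multiplies the
  function by a coordinate.\<close>

lemma null_moments_inner:
  assumes H: "open H" and w: "null_moments H w"
  shows "null_moments H (\<lambda>z. (z \<bullet> b) * w z)"
  unfolding null_moments_def
proof (intro conjI allI impI)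
  note cw = null_momentsD(2)[OF w]
  show cxw: "continuous_on UNIV (\<lambda>z. (z \<bullet> b) * w z)" by (intro continuous_intros cw)
  fix \<kappa> a assume \<kappa>: "radial_weight \<kappa>" and a: "a \<in> H"
  \<comment> \<open>The hypothesis is applied to the antiderivative \<open>X\<close>, so that its
    derivative in the centre brings back \<kappa>.\<close>
  obtain X where X: "radial_weight X" and X': "\<And>s. (X has_real_derivative \<kappa> s) (at s)"
    using radial_weight_antiderivative[OF \<kappa>] by blast
  obtain r where r: "r > 0" "ball a r \<subseteq> H" using H a open_contains_ball by blast
  \<comment> \<open>The scaling keeps the centre \<open>a + t *\<^sub>R c\<close> in the ball for
    every \<open>t\<close> between -1 and 1; the summand 1 covers \<open>b = 0\<close>.\<close>
  define k where "k = r / (2 * (norm b + 1))"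
  have nb: "0 < norm b + 1" by (simp add: add_nonneg_pos)
  have k0: "k > 0" using r nb by (simp add: k_def)
  define c where "c = k *\<^sub>R b"
  have nc: "norm c < r"
  proof -
    have "norm c = k * norm b" using k0 by (simp add: c_def)
    also have "\<dots> \<le> k * (norm b + 1)" using k0 by (intro mult_left_mono) auto
    also have "\<dots> = r / 2" unfolding k_def using nb by (simp add: field_simps)
    also have "\<dots> < r" using r by simp
    finally show ?thesis .
  qed
  have inH: "a + t *\<^sub>R c \<in> H" if "t \<in> {-1..1}" for t
  proof -
    have "norm (t *\<^sub>R c) \<le> norm c" using that by (auto simp: mult_left_le_one_le)
    then show ?thesis using nc r by (intro subsetD[OF r(2)]) (auto simp: dist_norm)
  qed
  have cX: "continuous_on UNIV X" and c\<kappa>: "continuous_on UNIV \<kappa>"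
    using X \<kappa> by (auto simp: radial_weight_def)
  obtain B where B: "\<And>z::'a. B \<le> norm z \<Longrightarrow> X ((norm (z - a))\<^sup>2) = 0"
    using cpt_cont_radial[OF X, of a] unfolding cpt_cont_def by blast
  obtain C where C: "\<And>z::'a. C \<le> norm z \<Longrightarrow> \<kappa> ((norm (z - a))\<^sup>2) = 0"
    using cpt_cont_radial[OF \<kappa>, of a] unfolding cpt_cont_def by blast
  have shift: "z - (a + t *\<^sub>R c) = z + t *\<^sub>R (-c) - a" for z t by simp
  define f' where "f' t z = \<kappa> ((norm (z - (a + t *\<^sub>R c)))\<^sup>2) * (2 * ((z - (a + t *\<^sub>R c)) \<bullet> (-c))) * w z" for t z
  have "integral UNIV (f' 0) = 0"
  proof (rule integral_derivative_eq_0[where f = "\<lambda>t z. X ((norm (z - (a + t *\<^sub>R c)))\<^sup>2) * w z"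
        and B = "max (B + norm c) C" and c = 0])
    fix t :: real and z assume t: "t \<in> {-1..1}"
    have "((\<lambda>t. X ((norm (z - (a + t *\<^sub>R c)))\<^sup>2)) has_real_derivative
       \<kappa> ((norm (z - (a + t *\<^sub>R c)))\<^sup>2) * (2 * ((z - (a + t *\<^sub>R c)) \<bullet> (-c)))) (at t)"
      unfolding shift by (rule DERIV_chain2[OF X' has_real_derivative_norm_square_line])
    then show "((\<lambda>t. X ((norm (z - (a + t *\<^sub>R c)))\<^sup>2) * w z) has_vector_derivative f' t z) (at t)"
      unfolding f'_def has_real_derivative_iff_has_vector_derivative[symmetric]
      by (rule DERIV_cmult_right)
    show "X ((norm (z - (a + t *\<^sub>R c)))\<^sup>2) * w z = 0" if "max (B + norm c) C \<le> norm z"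
    proof -
      have "norm (t *\<^sub>R c) \<le> norm c" using t by (auto simp: mult_left_le_one_le)
      then have "B \<le> norm (z - t *\<^sub>R c)" using that norm_triangle_ineq2[of z "t *\<^sub>R c"] by linarith
      moreover have "z - (a + t *\<^sub>R c) = (z - t *\<^sub>R c) - a" by simp
      ultimately show ?thesis using B by (simp only: mult_zero_left)
    qed
  next
    show "continuous_on UNIV (\<lambda>z. X ((norm (z - (a + t *\<^sub>R c)))\<^sup>2) * w z)" for t
      by (intro continuous_intros cw continuous_on_compose2[OF cX]) auto
    show "continuous_on ({-1..1} \<times> UNIV) (\<lambda>(t, z). f' t z)"
      unfolding case_prod_beta f'_def
      by (intro continuous_intros continuous_on_compose2[OF cw] continuous_on_compose2[OF c\<kappa>]) auto
    show "f' 0 z = 0" if "max (B + norm c) C \<le> norm z" for z using C that by (simp add: f'_def)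
    show "integral UNIV (\<lambda>z. X ((norm (z - (a + t *\<^sub>R c)))\<^sup>2) * w z) = 0" if "t \<in> {-1..1}" for t
      by (rule null_momentsD(1)[OF w X inH[OF that]])
  qed
  \<comment> \<open>The chain rule produces the coordinate of \<open>z - a\<close>, not of
    \<open>z\<close>. The extra term is \<open>a \<bullet> b\<close> times a moment of
    \<open>w\<close>, which vanishes by hypothesis.\<close>
  moreover have "f' 0 = (\<lambda>z. (-2 * k) * (\<kappa> ((norm (z - a))\<^sup>2) * ((z \<bullet> b) * w z) -
      (a \<bullet> b) * (\<kappa> ((norm (z - a))\<^sup>2) * w z)))"
  proof
    fix z
    have "(z - (a + 0 *\<^sub>R c)) \<bullet> (-c) = - k * ((z \<bullet> b) - (a \<bullet> b))"
      by (simp add: c_def inner_diff_left)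
    then show "f' 0 z = (-2 * k) * (\<kappa> ((norm (z - a))\<^sup>2) * ((z \<bullet> b) * w z) -
      (a \<bullet> b) * (\<kappa> ((norm (z - a))\<^sup>2) * w z))"
      unfolding f'_def by (simp only:) (simp add: right_diff_distrib left_diff_distrib mult_ac)
  qed
  ultimately have "(-2 * k) * integral UNIV (\<lambda>z. \<kappa> ((norm (z - a))\<^sup>2) * ((z \<bullet> b) * w z) - (a \<bullet> b) * (\<kappa> ((norm (z - a))\<^sup>2) * w z)) = 0"
    by (simp only: integral_mult_right)
  moreover have "-2 * k \<noteq> 0" using k0 by simp
  ultimately have "integral UNIV (\<lambda>z. \<kappa> ((norm (z - a))\<^sup>2) * ((z \<bullet> b) * w z) - (a \<bullet> b) * (\<kappa> ((norm (z - a))\<^sup>2) * w z)) = 0"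
    by simp
  then show "integral UNIV (\<lambda>z. \<kappa> ((norm (z - a))\<^sup>2) * ((z \<bullet> b) * w z)) = 0"
    by (subst (asm) Henstock_Kurzweil_Integration.integral_diff)
      (use radial_integrable[OF \<kappa> cxw, of a] integrable_cmul[OF radial_integrable[OF \<kappa> cw, of a], of "a \<bullet> b"]
        in \<open>simp_all add: null_momentsD(1)[OF w \<kappa> a]\<close>)
qed

lemma null_moments_polynomial:
  assumes "real_polynomial_function P" "open H" "null_moments H w"
  shows "null_moments H (\<lambda>z. P z * w z)"
  using assms
\<comment> \<open>The function \<open>w\<close> is generalised for the product case, where the first
  factor is applied to the second factor times \<open>w\<close>.\<close>
proof (induction P arbitrary: w rule: real_polynomial_function.induct)
  case (linear f)
  interpret bounded_linear f by fact
  have "f z * w z = (\<Sum>i\<in>Basis. f i * ((z \<bullet> i) * w z))" for z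
  proof -
    have "f z = f (\<Sum>i\<in>Basis. (z \<bullet> i) *\<^sub>R i)" by (simp only: euclidean_representation)
    also have "\<dots> = (\<Sum>i\<in>Basis. (z \<bullet> i) * f i)" by (simp only: sum scaleR real_scaleR_def)
    finally show ?thesis by (simp only: sum_distrib_right mult.assoc mult.left_commute)
  qed
  then have eq: "(\<lambda>z. f z * w z) = (\<lambda>z. \<Sum>i\<in>Basis. f i * ((z \<bullet> i) * w z))" by (rule ext)
  show ?case unfolding eq
    by (rule null_moments_sum[OF finite_Basis], rule null_moments_cmult, rule null_moments_inner)
      (rule linear.prems)+
next
  case (const c)
  show ?case by (rule null_moments_cmult) (rule const.prems)
next
  case (add f g)
  have "(\<lambda>z. (f z + g z) * w z) = (\<lambda>z. f z * w z + g z * w z)" by (rule ext) (rule distrib_right)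
  then show ?case using null_moments_add[OF add.IH(1)[OF add.prems] add.IH(2)[OF add.prems]] by (simp only:)
next
  case (mult f g)
  have "(\<lambda>z. (f z * g z) * w z) = (\<lambda>z. f z * (g z * w z))" by (rule ext) (rule mult.assoc)
  then show ?case using mult.IH(1)[OF mult.prems(1) mult.IH(2)[OF mult.prems]] by (simp only:)
qed

text \<open>With a nonnegative weight \<open>g\<close> and a polynomial \<open>P\<close> within
  \<epsilon> of \<open>w\<close> on the support of \<open>g\<close>, the integral of
  \<open>g * w * w\<close> equals that of \<open>g * (w - P) * w\<close>, which is at most
  \<epsilon> times the fixed number \<open>J\<close>. So \<open>g * w * w\<close> has integral 0 and
  vanishes by continuity.\<close>

lemma null_moments_imp_zero:
  assumes H: "open H" "H \<noteq> {}" and w: "null_moments H w"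
  shows "w z = 0"
proof -
  obtain a where a: "a \<in> H" using H by blast
  \<comment> \<open>The added 1 gives \<open>g\<close> the value 1 at the point \<open>z\<close>
    under consideration.\<close>
  define R where "R = (norm (z - a))\<^sup>2 + 1"
  define \<kappa> where "\<kappa> s = max 0 (R - s)" for s
  define g where "g x = \<kappa> ((norm (x - a))\<^sup>2)" for x
  have \<kappa>: "radial_weight \<kappa>"
    unfolding radial_weight_def \<kappa>_def by (auto intro!: continuous_intros exI[of _ R])
  note cw = null_momentsD(2)[OF w]
  have cg: "cpt_cont g" unfolding g_def by (rule cpt_cont_radial[OF \<kappa>])
  have g0: "g x \<ge> 0" for x by (simp add: g_def \<kappa>_def)
  have cont: "cpt_cont (\<lambda>x. g x *\<^sub>R u x)" if "continuous_on UNIV u" for u :: "'a \<Rightarrow> real"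
    by (rule cpt_cont_scaleR[OF cg that])
  note int = cpt_cont_integrable[OF cont, unfolded real_scaleR_def]
  define J where "J = integral UNIV (\<lambda>x. g x * \<bar>w x\<bar>)"
  have "J \<ge> 0" unfolding J_def
    by (intro Henstock_Kurzweil_Integration.integral_nonneg int continuous_intros cw) (auto simp: g0)
  obtain B where B: "\<And>x. B \<le> norm x \<Longrightarrow> g x = 0" using cg unfolding cpt_cont_def by blast
  have le: "integral UNIV (\<lambda>x. g x * (w x * w x)) \<le> \<epsilon> * J" if \<epsilon>: "\<epsilon> > 0" for \<epsilon>
  proof -
    obtain P where P: "real_polynomial_function P" "\<And>x. x \<in> cball 0 B \<Longrightarrow> \<bar>w x - P x\<bar> < \<epsilon>"
      using Stone_Weierstrass_real_polynomial_function[OF compact_cball continuous_on_subset[OF cw subset_UNIV] \<epsilon>]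
      by blast
    have cP: "continuous_on UNIV P" 
      using P(1) continuous_on_polymonial_function real_polynomial_function_eq by blast
    have "integral UNIV (\<lambda>x. g x * (P x * w x)) = 0"
      using null_momentsD(1)[OF null_moments_polynomial[OF P(1) H(1) w] \<kappa> a] by (simp add: g_def)
    then have "integral UNIV (\<lambda>x. g x * (w x * w x)) = integral UNIV (\<lambda>x. g x * (w x * w x) - g x * (P x * w x))"
      by (subst Henstock_Kurzweil_Integration.integral_diff) (auto intro!: int continuous_intros cw cP)
    also have "\<dots> \<le> integral UNIV (\<lambda>x. \<epsilon> * (g x * \<bar>w x\<bar>))"
    proof (rule integral_le)
      show "(\<lambda>x. g x * (w x * w x) - g x * (P x * w x)) integrable_on UNIV"
        by (intro Henstock_Kurzweil_Integration.integrable_diff int continuous_intros cw cP)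
      show "(\<lambda>x. \<epsilon> * (g x * \<bar>w x\<bar>)) integrable_on UNIV"
        by (intro integrable_cmul[where 'b=real, unfolded real_scaleR_def] int continuous_intros cw)
      fix x
      show "g x * (w x * w x) - g x * (P x * w x) \<le> \<epsilon> * (g x * \<bar>w x\<bar>)"
      proof (cases "B \<le> norm x")
        case False
        then have "\<bar>w x - P x\<bar> \<le> \<epsilon>" using P(2)[of x] by simp
        then have "(w x - P x) * w x \<le> \<epsilon> * \<bar>w x\<bar>"
          by (metis abs_ge_self abs_ge_zero abs_mult mult_right_mono order_trans)
        then have "g x * ((w x - P x) * w x) \<le> g x * (\<epsilon> * \<bar>w x\<bar>)" by (intro mult_left_mono g0)
        then show ?thesis by (simp add: algebra_simps)
      qed (simp add: B)
    qed
    finally show ?thesis by (simp add: J_def)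
  qed
  have I0: "integral UNIV (\<lambda>x. g x * (w x * w x)) = 0"
  proof (rule antisym)
    show "integral UNIV (\<lambda>x. g x * (w x * w x)) \<le> 0"
    proof (rule field_le_epsilon)
      fix e :: real assume "e > 0"
      \<comment> \<open>The number \<open>J\<close> may be 0, hence the denominator
        \<open>J + 1\<close>.\<close>
      with le[of "e / (J + 1)"] \<open>J \<ge> 0\<close>
      have "integral UNIV (\<lambda>x. g x * (w x * w x)) \<le> e / (J + 1) * J" by simp
      also have "\<dots> \<le> e" using \<open>J \<ge> 0\<close> \<open>e > 0\<close> by (simp add: divide_simps)
      finally show "integral UNIV (\<lambda>x. g x * (w x * w x)) \<le> 0 + e" by simp
    qed
    show "0 \<le> integral UNIV (\<lambda>x. g x * (w x * w x))"
      by (intro Henstock_Kurzweil_Integration.integral_nonneg int continuous_intros cw) (auto simp: g0)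
  qed
  \<comment> \<open>The box contains the support of \<open>g\<close>, and has \<open>z\<close> in
    its interior, which also shows that the interior is nonempty.\<close>
  obtain c where c: "cball (0::'a) (max B (norm z)) \<subseteq> box (-c) c"
    using bounded_subset_box_symmetric[OF bounded_cball] by blast
  have cc: "continuous_on UNIV (\<lambda>x. g x * (w x * w x))"
    by (intro continuous_intros cw cpt_contD[OF cg])
  have out: "g x * (w x * w x) = 0" if "x \<notin> cbox (-c) c" for x
  proof -
    have "x \<notin> cball 0 (max B (norm z))" using c that box_subset_cbox by blast
    then show ?thesis using B[of x] by simp
  qed
  have z: "z \<in> box (-c) c" using c by auto
  have "g z * (w z * w z) = 0"
  proof (rule has_integral_0_cbox_imp_0[where f = "\<lambda>x. g x * (w x * w x)" and a = "-c" and b = c])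
    show "((\<lambda>x. g x * (w x * w x)) has_integral 0) (cbox (-c) c)"
      using integrable_integral[OF integrable_continuous[OF continuous_on_subset[OF cc subset_UNIV]], of "-c" c]
        integral_eq_cbox(2)[OF cc out] I0 by simp
    show "continuous_on (cbox (-c) c) (\<lambda>x. g x * (w x * w x))"
      by (rule continuous_on_subset[OF cc subset_UNIV])
    show "z \<in> cbox (-c) c" using z box_subset_cbox by blast
  qed (use z g0 in auto)
  moreover have "g z = 1" by (simp add: g_def \<kappa>_def R_def)
  ultimately show ?thesis by simp
qed

section \<open>Unique continuation for first-order elliptic systems\<close>

lemma integral_cpt_cont_linear:
  assumes "bounded_linear h" "cpt_cont F"
  shows "integral UNIV (\<lambda>z. h (F z)) = h (integral UNIV F)"
  using integral_linear[OF cpt_cont_integrable[OF assms(2)] assms(1)] by (simp add: comp_def)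

lemma radial_weight_mult:
  assumes "radial_weight \<kappa>" "continuous_on UNIV h"
  shows "radial_weight (\<lambda>s. \<kappa> s * h s)" "radial_weight (\<lambda>s. h s * \<kappa> s)"
  using assms unfolding radial_weight_def by (auto intro!: continuous_intros)

lemma radial_weight_add:
  assumes "radial_weight f" "radial_weight g"
  shows "radial_weight (\<lambda>s. f s + g s)"
proof -
  from assms obtain B C where "\<forall>s\<ge>B. f s = 0" "\<forall>s\<ge>C. g s = 0" unfolding radial_weight_def by blast
  then have "\<forall>s\<ge>max B C. f s + g s = 0" by simp
  then have "\<exists>B. \<forall>s\<ge>B. f s + g s = 0" by blast
  then show ?thesis using assms unfolding radial_weight_def by (blast intro: continuous_on_add)
qed

text \<open>Beyond \<open>\<delta>\<close> the solution is \<open>s powr (- N / 2)\<close> times an antiderivative; replacing \<open>s\<close> by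
  \<open>max s \<delta>\<close> in the integrating factor keeps it continuously differentiable through \<open>s = 0\<close>.\<close>

lemma radial_ode:
  fixes N :: real
  assumes \<kappa>: "radial_weight \<kappa>" and \<delta>: "\<delta> > 0"
  obtains g g' where "radial_weight g" "radial_weight g'" "\<And>s. (g has_real_derivative g' s) (at s)"
    "\<And>s. s \<ge> \<delta> \<Longrightarrow> 2 * s * g' s + N * g s = \<kappa> s"
proof -
  have c: "continuous_on UNIV (\<lambda>s. 1 / max s \<delta>)" using \<delta> by (intro continuous_intros) auto
  \<comment> \<open>For \<open>s \<ge> \<delta>\<close> this \<open>l\<close> is \<open>ln s\<close>
    up to a constant, so \<open>h\<close> is there a multiple of the power named above.\<close>
  obtain l where l: "\<And>s. (l has_vector_derivative 1 / max s \<delta>) (at s)"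
    using einterval_antiderivative[of "-\<infinity>" "\<infinity>" "\<lambda>s. 1 / max s \<delta>"] c
    by (auto simp: continuous_on_eq_continuous_at)
  define h where "h s = exp (- (N / 2) * l s)" for s
  define h' where "h' s = - (N / 2) * (1 / max s \<delta>) * h s" for s
  have h: "(h has_real_derivative h' s) (at s)" for s
    unfolding h_def h'_def using l[of s]
    by (auto intro!: derivative_eq_intros simp: has_real_derivative_iff_has_vector_derivative[symmetric])
  have hpos: "h s > 0" for s by (simp add: h_def)
  have ch: "continuous_on UNIV h" using h DERIV_continuous_on by blast
  have ch': "continuous_on UNIV h'" unfolding h'_def by (intro continuous_intros c ch)
  have cq: "continuous_on UNIV (\<lambda>s. 1 / (2 * max s \<delta> * h s))"
    using \<delta> hpos by (intro continuous_intros ch) (auto simp: less_imp_neq[THEN not_sym])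
  \<comment> \<open>Variation of constants: \<open>h\<close> solves the homogeneous equation for
    \<open>s \<ge> \<delta>\<close>, and \<open>k\<close> is the derivative that the coefficient
    \<Psi> must have for \<open>h * \<Psi>\<close> to solve the full one.\<close>
  define k where "k s = \<kappa> s * (1 / (2 * max s \<delta> * h s))" for s
  have k: "radial_weight k" unfolding k_def by (rule radial_weight_mult(1)[OF \<kappa> cq])
  obtain \<Psi> where \<Psi>: "radial_weight \<Psi>" "\<And>s. (\<Psi> has_real_derivative k s) (at s)"
    using radial_weight_antiderivative[OF k] by blast
  show ?thesis
  proof (rule that[of "\<lambda>s. h s * \<Psi> s" "\<lambda>s. h' s * \<Psi> s + h s * k s"])
    show "radial_weight (\<lambda>s. h s * \<Psi> s)" by (rule radial_weight_mult(2)[OF \<Psi>(1) ch])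
    show "radial_weight (\<lambda>s. h' s * \<Psi> s + h s * k s)"
      by (intro radial_weight_add radial_weight_mult(2) \<Psi> k ch ch')
    show "((\<lambda>s. h s * \<Psi> s) has_real_derivative h' s * \<Psi> s + h s * k s) (at s)" for s
      using DERIV_mult[OF h[of s] \<Psi>(2)[of s]] by (simp add: mult.commute)
    show "2 * s * (h' s * \<Psi> s + h s * k s) + N * (h s * \<Psi> s) = \<kappa> s" if "s \<ge> \<delta>" for s
    proof -
      have m: "max s \<delta> = s" "s \<noteq> 0" using that \<delta> by auto
      have "2 * s * h' s = - N * h s" using m by (simp add: h'_def)
      moreover have "2 * s * (h s * k s) = \<kappa> s" using m hpos[of s] by (simp add: k_def)
      ultimately show ?thesis by (simp add: distrib_left mult.assoc[symmetric])
    qed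
  qed
qed

text \<open>The algebraic form of the factorisation of the Laplacian as the product of the conjugate
  operator and the first-order operator; the matrix plays the role of the Hessian.\<close>

lemma clifford_factorisation:
  fixes W :: "'i \<Rightarrow> 'i \<Rightarrow> 'b::real_vector" and L :: "'i \<Rightarrow> 'b \<Rightarrow> 'b"
  assumes J: "finite J" "u \<in> J" and lin: "\<And>j. j \<in> J \<Longrightarrow> linear (L j)"
    and Lu: "\<And>w. L u w = w"
    and anti: "\<And>i j w. i \<in> J - {u} \<Longrightarrow> j \<in> J - {u} \<Longrightarrow> L i (L j w) + L j (L i w) = (if i = j then - 2 *\<^sub>R w else 0)"
    and sym: "\<And>i j. i \<in> J \<Longrightarrow> j \<in> J \<Longrightarrow> W i j = W j i"
  shows "(\<Sum>j\<in>J. L j (W u j)) - (\<Sum>i\<in>J - {u}. L i (\<Sum>j\<in>J. L j (W i j))) = (\<Sum>j\<in>J. W j j)"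
proof -
  let ?K = "J - {u}"
  have fK: "finite ?K" using J by simp
  have split: "(\<Sum>j\<in>J. f j) = f u + (\<Sum>j\<in>?K. f j)" for f :: "'i \<Rightarrow> 'b"
    using J by (rule sum.remove)
  define S where "S = (\<Sum>i\<in>?K. \<Sum>j\<in>?K. L i (L j (W i j)))"
  \<comment> \<open>By symmetry of \<open>W\<close> the double sum is unchanged when the two
    operators are exchanged. Twice the sum then contains only anticommutators, and these leave the
    diagonal.\<close>
  have "S = (\<Sum>i\<in>?K. \<Sum>j\<in>?K. L j (L i (W j i)))"
    unfolding S_def by (rule sum.swap)
  also have "\<dots> = (\<Sum>i\<in>?K. \<Sum>j\<in>?K. L j (L i (W i j)))"
    using sym by (intro sum.cong refl) auto
  finally have "S + S = (\<Sum>i\<in>?K. \<Sum>j\<in>?K. L i (L j (W i j)) + L j (L i (W i j)))"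
    by (simp only: S_def sum.distrib)
  also have "\<dots> = (\<Sum>i\<in>?K. \<Sum>j\<in>?K. (if i = j then - 2 *\<^sub>R W i j else 0))"
    by (intro sum.cong refl anti)
  also have "\<dots> = (\<Sum>i\<in>?K. - 2 *\<^sub>R W i i)"
    using fK by (intro sum.cong refl) (simp add: sum.delta)
  also have "\<dots> = - 2 *\<^sub>R (\<Sum>i\<in>?K. W i i)" by (simp only: scaleR_sum_right)
  finally have "2 *\<^sub>R S = 2 *\<^sub>R (- (\<Sum>i\<in>?K. W i i))" by (simp add: scaleR_2)
  then have S: "S = - (\<Sum>i\<in>?K. W i i)" by (metis scaleR_left_imp_eq zero_neq_numeral)
  have "(\<Sum>i\<in>?K. L i (\<Sum>j\<in>J. L j (W i j))) = (\<Sum>i\<in>?K. L i (W i u) + (\<Sum>j\<in>?K. L i (L j (W i j))))"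
    using lin by (intro sum.cong refl) (simp add: split linear_add linear_sum Lu)
  \<comment> \<open>Symmetry turns the column of \<open>u\<close> into its row, so the mixed terms
    cancel against those of \<open>L j (W u j)\<close>.\<close>
  also have "\<dots> = (\<Sum>i\<in>?K. L i (W u i)) + S"
    using sym[OF _ J(2)] by (simp add: S_def sum.distrib)
  finally show ?thesis by (simp add: split Lu S)
qed

text \<open>Integrate by parts against the gradient field \<open>g(|z - a|\<^sup>2) (z - a)\<close>; the weight in the conclusion is
  its divergence.\<close>

lemma elliptic_system_radial:
  fixes U :: "'a::euclidean_space \<Rightarrow> 'b::euclidean_space" and d :: "'a \<Rightarrow> 'a \<Rightarrow> 'b" and L :: "'a \<Rightarrow> 'b \<Rightarrow> 'b"
    and g g' :: "real \<Rightarrow> real"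
  assumes J: "J \<subseteq> Basis" "u \<in> J" and lin: "\<And>j. j \<in> J \<Longrightarrow> linear (L j)"
    and Lu: "\<And>w. L u w = w"
    and anti: "\<And>i j w. i \<in> J - {u} \<Longrightarrow> j \<in> J - {u} \<Longrightarrow> L i (L j w) + L j (L i w) = (if i = j then - 2 *\<^sub>R w else 0)"
    and U: "continuous_on UNIV U"
    and d: "\<And>j. j \<in> Basis \<Longrightarrow> continuous_on UNIV (d j)"
    and der: "\<And>j z. j \<in> Basis \<Longrightarrow> ((\<lambda>t. U (z + t *\<^sub>R j)) has_vector_derivative d j z) (at 0)"
    and d0: "\<And>j z. j \<in> Basis - J \<Longrightarrow> d j z = 0"
    and eqn: "\<And>z. (\<Sum>j\<in>J. L j (d j z)) = 0"
    and g: "radial_weight g" "radial_weight g'" "\<And>s. (g has_real_derivative g' s) (at s)"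
  shows "integral UNIV (\<lambda>z. (2 * (norm (z - a))\<^sup>2 * g' ((norm (z - a))\<^sup>2) + real DIM('a) * g ((norm (z - a))\<^sup>2)) *\<^sub>R U z) = 0"
proof -
  define s where "s z = (norm (z - a))\<^sup>2" for z
  define \<psi> where "\<psi> i z = g (s z) * ((z - a) \<bullet> i)" for i z
  \<comment> \<open>This is the derivative of \<open>\<psi> i\<close> in direction \<open>j\<close>:
    the Hessian of one half of an antiderivative of \<open>g\<close>, taken at the squared
    distance.\<close>
  define m where "m i j z = g' (s z) * (2 * ((z - a) \<bullet> i) * ((z - a) \<bullet> j)) + g (s z) * (i \<bullet> j)" for i j z
  define W where "W i j = integral UNIV (\<lambda>z. m i j z *\<^sub>R U z)" for i j
  have gs: "cpt_cont (\<lambda>z. g (s z))" "cpt_cont (\<lambda>z. g' (s z))"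
    unfolding s_def by (intro cpt_cont_radial g)+
  have c\<psi>: "cpt_cont (\<psi> i)" for i
    unfolding \<psi>_def using cpt_cont_scaleR[OF gs(1), of "\<lambda>z. (z - a) \<bullet> i"]
    by (simp add: continuous_intros)
  have cm: "cpt_cont (m i j)" for i j
    unfolding m_def using cpt_cont_scaleR[OF gs(2), of "\<lambda>z. 2 * ((z - a) \<bullet> i) * ((z - a) \<bullet> j)"]
      cpt_cont_scaleR[OF gs(1), of "\<lambda>z. i \<bullet> j"]
    by (intro cpt_cont_add) (simp_all add: continuous_intros)
  have d\<psi>: "((\<lambda>t. \<psi> i (z + t *\<^sub>R j)) has_real_derivative m i j z) (at 0)" for i j z
  proof -
    have "((\<lambda>t. g (s (z + t *\<^sub>R j))) has_real_derivative g' (s z) * (2 * ((z - a) \<bullet> j))) (at 0)"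
      using DERIV_chain2[OF g(3) has_real_derivative_norm_square_line[of z j a 0]] by (simp add: s_def)
    moreover have "((\<lambda>t. (z + t *\<^sub>R j - a) \<bullet> i) has_real_derivative (i \<bullet> j)) (at 0)"
    proof -
      have "(\<lambda>t. (z + t *\<^sub>R j - a) \<bullet> i) = (\<lambda>t. (z - a) \<bullet> i + t * (i \<bullet> j))"
        by (auto simp: inner_simps inner_commute)
      then show ?thesis by (auto intro!: derivative_eq_intros)
    qed
    ultimately show ?thesis
      unfolding \<psi>_def using DERIV_mult by (fastforce simp: m_def algebra_simps)
  qed
  have W: "W i j = - integral UNIV (\<lambda>z. \<psi> i z *\<^sub>R d j z)" if "j \<in> Basis" for i j
    unfolding W_def by (rule integration_by_parts[OF U d[OF that] c\<psi> cm der[OF that] d\<psi>])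
  have "(\<Sum>j\<in>J. W j j) = 0"
  proof -
    have sym: "W i j = W j i" for i j by (simp add: W_def m_def inner_commute mult_ac)
    \<comment> \<open>After integration by parts each \<open>W i j\<close> carries
      \<open>d j\<close> under the integral with the common factor \<open>\<psi> i\<close>, so the
      sum over \<open>j\<close> reproduces the differential equation.\<close>
    have null: "(\<Sum>j\<in>J. L j (W i j)) = 0" for i
    proof -
      have "(\<Sum>j\<in>J. L j (W i j)) = (\<Sum>j\<in>J. - integral UNIV (\<lambda>z. \<psi> i z *\<^sub>R L j (d j z)))"
      proof (intro sum.cong refl)
        fix j assume j: "j \<in> J"
        then have jB: "j \<in> Basis" and lj: "linear (L j)" using J lin by auto
        have "L j (W i j) = - L j (integral UNIV (\<lambda>z. \<psi> i z *\<^sub>R d j z))"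
          by (simp add: W[OF jB] linear_neg[OF lj])
        also have "L j (integral UNIV (\<lambda>z. \<psi> i z *\<^sub>R d j z)) = integral UNIV (\<lambda>z. L j (\<psi> i z *\<^sub>R d j z))"
          using integral_cpt_cont_linear[OF _ cpt_cont_scaleR[OF c\<psi> d[OF jB]], of "L j"] lj
          by (simp add: linear_conv_bounded_linear)
        finally show "L j (W i j) = - integral UNIV (\<lambda>z. \<psi> i z *\<^sub>R L j (d j z))"
          by (simp add: linear_cmul[OF lj])
      qed
      also have "\<dots> = - (\<Sum>j\<in>J. integral UNIV (\<lambda>z. \<psi> i z *\<^sub>R L j (d j z)))"
        by (rule sum_negf)
      also have "(\<Sum>j\<in>J. integral UNIV (\<lambda>z. \<psi> i z *\<^sub>R L j (d j z))) =
          integral UNIV (\<lambda>z. \<Sum>j\<in>J. \<psi> i z *\<^sub>R L j (d j z))"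
      proof (rule Henstock_Kurzweil_Integration.integral_sum[symmetric])
        show "finite J" using J finite_Basis finite_subset by blast
        fix j assume j: "j \<in> J"
        then have "bounded_linear (L j)" "continuous_on UNIV (d j)"
          using lin d J linear_conv_bounded_linear by blast+
        then have "continuous_on UNIV (\<lambda>z. L j (d j z))" by (rule bounded_linear.continuous_on)
        then show "(\<lambda>z. \<psi> i z *\<^sub>R L j (d j z)) integrable_on UNIV"
          by (intro cpt_cont_integrable cpt_cont_scaleR c\<psi>)
      qed
      also have "\<dots> = 0" by (simp only: scaleR_sum_right[symmetric] eqn) simp
      finally show ?thesis by simp
    qed
    have "(\<Sum>i\<in>J - {u}. L i (\<Sum>j\<in>J. L j (W i j))) = 0"
      using lin by (intro sum.neutral) (simp add: null linear_0)
    then show ?thesis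
      using clifford_factorisation[where W = W, OF finite_subset[OF J(1) finite_Basis] J(2) lin Lu anti sym] null by simp
  qed
  \<comment> \<open>Derivatives in directions outside \<open>J\<close> vanish, so the trace over
    \<open>J\<close> equals the trace over the whole basis. This is why the divergence involves
    \<open>DIM('a)\<close> and not the size of \<open>J\<close>.\<close>
  moreover have "W j j = 0" if "j \<in> Basis - J" for j
    using W[of j j] that d0[OF that] by simp
  then have "(\<Sum>j\<in>Basis. W j j) = (\<Sum>j\<in>J. W j j)"
    using J by (intro sum.mono_neutral_right) auto
  moreover have "(\<Sum>j\<in>Basis. W j j) = integral UNIV (\<lambda>z. \<Sum>j\<in>Basis. m j j z *\<^sub>R U z)"
    unfolding W_def by (intro Henstock_Kurzweil_Integration.integral_sum[symmetric] finite_Basis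
        cpt_cont_integrable cpt_cont_scaleR cm U)
  moreover have "(\<Sum>j\<in>Basis. m j j z *\<^sub>R U z) = (2 * s z * g' (s z) + real DIM('a) * g (s z)) *\<^sub>R U z" for z
  proof -
    have "s z = (\<Sum>j\<in>Basis. ((z - a) \<bullet> j) * ((z - a) \<bullet> j))"
      unfolding s_def power2_norm_eq_inner by (rule euclidean_inner)
    then have "(\<Sum>j\<in>Basis. m j j z) = 2 * s z * g' (s z) + real DIM('a) * g (s z)"
      by (simp add: m_def sum.distrib sum_distrib_left mult_ac)
    then show ?thesis by (simp add: scaleR_sum_left[symmetric])
  qed
  ultimately show ?thesis by (simp add: s_def)
qed

text \<open>If \<open>U\<close> vanishes within distance \<open>r\<close> of \<open>a\<close>, the
  divergence of the test field has to equal the prescribed weight only from the squared distance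
  \<open>r\<^sup>2\<close> on, and \<open>radial_ode\<close> with
  \<open>\<delta> = r\<^sup>2\<close> supplies such a field. Allowing \<open>J\<close> to be smaller
  than the basis lets a problem of lower dimension be treated inside \<open>'a\<close>.\<close>

lemma elliptic_system_unique_continuation:
  fixes U :: "'a::euclidean_space \<Rightarrow> 'b::euclidean_space" and d :: "'a \<Rightarrow> 'a \<Rightarrow> 'b" and L :: "'a \<Rightarrow> 'b \<Rightarrow> 'b"
  assumes J: "J \<subseteq> Basis" "u \<in> J" and lin: "\<And>j. j \<in> J \<Longrightarrow> linear (L j)"
    and Lu: "\<And>w. L u w = w"
    and anti: "\<And>i j w. i \<in> J - {u} \<Longrightarrow> j \<in> J - {u} \<Longrightarrow> L i (L j w) + L j (L i w) = (if i = j then - 2 *\<^sub>R w else 0)"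
    and U: "continuous_on UNIV U"
    and d: "\<And>j. j \<in> Basis \<Longrightarrow> continuous_on UNIV (d j)"
    and der: "\<And>j z. j \<in> Basis \<Longrightarrow> ((\<lambda>t. U (z + t *\<^sub>R j)) has_vector_derivative d j z) (at 0)"
    and d0: "\<And>j z. j \<in> Basis - J \<Longrightarrow> d j z = 0"
    and eqn: "\<And>z. (\<Sum>j\<in>J. L j (d j z)) = 0"
    and H: "open H" "H \<noteq> {}" "\<And>z. z \<in> H \<Longrightarrow> U z = 0"
  shows "U z = 0"
proof (rule euclidean_eqI)
  fix b :: 'b assume b: "b \<in> Basis"
  have "null_moments H (\<lambda>z. U z \<bullet> b)"
    unfolding null_moments_def
  proof (intro conjI allI impI)
    show "continuous_on UNIV (\<lambda>z. U z \<bullet> b)" by (intro continuous_intros U)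
    fix \<kappa> a assume \<kappa>: "radial_weight \<kappa>" and a: "a \<in> H"
    obtain r where r: "r > 0" "ball a r \<subseteq> H" using H a open_contains_ball by blast
    have Uz: "U z = 0" if "(norm (z - a))\<^sup>2 < r\<^sup>2" for z
    proof -
      have "norm (z - a) < r" using that r by (intro power2_less_imp_less[of _ r]) auto
      then have "z \<in> ball a r" by (simp add: dist_norm norm_minus_commute)
      then show ?thesis using r H(3) by blast
    qed
    have "r\<^sup>2 > 0" using r by simp
    obtain g g' :: "real \<Rightarrow> real" where g: "radial_weight g" "radial_weight g'"
      "\<And>s. (g has_real_derivative g' s) (at s)"
      "\<And>s. s \<ge> r\<^sup>2 \<Longrightarrow> 2 * s * g' s + real DIM('a) * g s = \<kappa> s"
      by (rule radial_ode[OF \<kappa> \<open>r\<^sup>2 > 0\<close>, of "real DIM('a)"]) (rule that)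
    have "(2 * (norm (z - a))\<^sup>2 * g' ((norm (z - a))\<^sup>2) + real DIM('a) * g ((norm (z - a))\<^sup>2)) *\<^sub>R U z =
        \<kappa> ((norm (z - a))\<^sup>2) *\<^sub>R U z" for z
      using Uz[of z] g(4)[of "(norm (z - a))\<^sup>2"] by (cases "(norm (z - a))\<^sup>2 < r\<^sup>2") auto
    then have "integral UNIV (\<lambda>z. \<kappa> ((norm (z - a))\<^sup>2) *\<^sub>R U z) = 0"
      using elliptic_system_radial[OF J lin Lu anti U d der d0 eqn g(1-3), of a] by (simp only:)
    then show "integral UNIV (\<lambda>z. \<kappa> ((norm (z - a))\<^sup>2) * (U z \<bullet> b)) = 0"
      using integral_cpt_cont_linear[OF bounded_linear_inner_left[of b] cpt_cont_scaleR[OF cpt_cont_radial[OF \<kappa>] U], of a]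
      by simp
  qed
  then have "U z \<bullet> b = 0" by (rule null_moments_imp_zero[OF H(1,2)])
  then show "U z \<bullet> b = 0 \<bullet> b" by simp
qed

section \<open>Vector-valued polynomials\<close>

abbreviation power_prod :: "nat \<Rightarrow> (nat \<Rightarrow> nat) \<Rightarrow> (nat \<Rightarrow> real) \<Rightarrow> real" where
  "power_prod p \<alpha> x \<equiv> (\<Prod>s\<le>p. x s ^ \<alpha> s)"

text \<open>The number \<open>d\<close> is a strict bound for the total degree, so that \<open>d = 0\<close> forces the polynomial to
  vanish and the truncated \<open>d - 1\<close> bounds the degree of a derivative in every case.\<close>

inductive mpoly :: "nat \<Rightarrow> nat \<Rightarrow> ((nat \<Rightarrow> real) \<Rightarrow> 'a::real_normed_vector) \<Rightarrow> bool" for p d where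
  zero: "mpoly p d (\<lambda>x. 0)"
| add: "mpoly p d f \<Longrightarrow> sum \<alpha> {..p} < d \<Longrightarrow> mpoly p d (\<lambda>x. f x + power_prod p \<alpha> x *\<^sub>R c)"

lemma mpoly_monom: "sum \<alpha> {..p} < d \<Longrightarrow> mpoly p d (\<lambda>x. power_prod p \<alpha> x *\<^sub>R c)"
  using mpoly.add[OF mpoly.zero] by fastforce

lemma mpoly_add:
  assumes "mpoly p d f" "mpoly p d g"
  shows "mpoly p d (\<lambda>x. f x + g x)"
  using assms(2)
proof induction
  case zero
  then show ?case using assms(1) by simp
next
  case (add g \<alpha> c)
  then show ?case using mpoly.add[of p d "\<lambda>x. f x + g x" \<alpha> c] by (simp add: add.assoc)
qed

lemma mpoly_sum:
  assumes "finite I" "\<And>i. i \<in> I \<Longrightarrow> mpoly p d (f i)"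
  shows "mpoly p d (\<lambda>x. \<Sum>i\<in>I. f i x)"
  using assms by (induction I rule: finite_induct) (auto intro: mpoly.zero mpoly_add)

lemma mpoly_mono: "mpoly p d f \<Longrightarrow> d \<le> d' \<Longrightarrow> mpoly p d' f"
  by (induction rule: mpoly.induct) (auto intro: mpoly.intros)

lemma mpoly_0: "mpoly p 0 f \<Longrightarrow> f x = 0"
  by (erule mpoly.cases) auto

lemma mpoly_linear:
  assumes "linear L" "mpoly p d f"
  shows "mpoly p d (\<lambda>x. L (f x))"
  using assms(2)
proof induction
  case zero
  then show ?case by (simp add: linear_0[OF assms(1)] mpoly.zero)
next
  case (add f \<alpha> c)
  then show ?case by (simp add: linear_add[OF assms(1)] linear_cmul[OF assms(1)] mpoly.add)
qed

lemma is_poly_mpoly: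
  assumes "is_poly p f"
  obtains d where "mpoly p d f"
proof -
  from assms obtain I c where I: "finite I" and f: "f = (\<lambda>x. \<Sum>\<alpha>\<in>I. power_prod p \<alpha> x *\<^sub>R c \<alpha>)"
    unfolding is_poly_def by blast
  \<comment> \<open>The sum of all degrees bounds each of them; the successor makes the bound
    strict.\<close>
  have "mpoly p (Suc (\<Sum>\<alpha>\<in>I. sum \<alpha> {..p})) f"
    unfolding f
  proof (intro mpoly_sum I mpoly_monom)
    fix \<alpha> assume "\<alpha> \<in> I"
    then show "sum \<alpha> {..p} < Suc (\<Sum>\<alpha>\<in>I. sum \<alpha> {..p})"
      using I member_le_sum[of \<alpha> I "\<lambda>\<alpha>. sum \<alpha> {..p}"] by simp
  qed
  then show ?thesis by (rule that)
qed

lemma mpoly_cong: "mpoly p d f \<Longrightarrow> (\<And>s. s \<le> p \<Longrightarrow> x s = y s) \<Longrightarrow> f x = f y"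
  by (induction rule: mpoly.induct) auto

section \<open>Partial derivatives of polynomials\<close>

lemma monom_has_derivative:
  assumes "t \<le> p"
  shows "((\<lambda>\<tau>. power_prod p \<alpha> (x(t := \<tau>)) *\<^sub>R c) has_vector_derivative
    (power_prod p (\<alpha>(t := \<alpha> t - 1)) x *\<^sub>R (real (\<alpha> t) *\<^sub>R c))) (at (x t))"
proof -
  have *: "(\<Prod>s\<in>{..p}. f s) = f t * (\<Prod>s\<in>{..p} - {t}. f s)" for f :: "nat \<Rightarrow> real"
    using assms by (intro prod.remove) auto
  let ?r = "\<Prod>s\<in>{..p} - {t}. x s ^ \<alpha> s"
  have "(\<lambda>\<tau>. power_prod p \<alpha> (x(t := \<tau>)) *\<^sub>R c) = (\<lambda>\<tau>. (\<tau> ^ \<alpha> t * ?r) *\<^sub>R c)"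
    by (subst *) simp
  moreover have "power_prod p (\<alpha>(t := \<alpha> t - 1)) x = x t ^ (\<alpha> t - 1) * ?r"
    by (subst *) simp
  \<comment> \<open>For \<open>\<alpha> t = 0\<close> the truncated exponent
    \<open>\<alpha> t - 1\<close> is harmless, because the factor \<open>real (\<alpha> t)\<close>
    is then 0.\<close>
  moreover have "((\<lambda>\<tau>. \<tau> ^ \<alpha> t * ?r) has_real_derivative real (\<alpha> t) * x t ^ (\<alpha> t - 1) * ?r) (at (x t))"
    by (auto intro!: derivative_eq_intros)
  then have "((\<lambda>\<tau>. (\<tau> ^ \<alpha> t * ?r) *\<^sub>R c) has_vector_derivative (real (\<alpha> t) * x t ^ (\<alpha> t - 1) * ?r) *\<^sub>R c) (at (x t))"
    using has_vector_derivative_scaleR[OF _ has_vector_derivative_const[of c]] by fastforce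
  ultimately show ?thesis by (simp add: mult_ac)
qed

lemma pdiff_monom:
  "t \<le> p \<Longrightarrow> pdiff t (\<lambda>x. power_prod p \<alpha> x *\<^sub>R c) x = power_prod p (\<alpha>(t := \<alpha> t - 1)) x *\<^sub>R (real (\<alpha> t) *\<^sub>R c)"
  unfolding pdiff_def by (rule vector_derivative_at[OF monom_has_derivative])

text \<open>The value of \<open>pdiff\<close> is meaningful only where the derivative exists; this
  existence is what the rules for sums and linear maps below rest on.\<close>

lemma mpoly_pdiff_has_derivative:
  assumes "mpoly p d f" "t \<le> p"
  shows "((\<lambda>\<tau>. f (x(t := \<tau>))) has_vector_derivative pdiff t f x) (at (x t))"
  using assms(1)
proof induction
  case zero
  show ?case by (simp add: pdiff_def)
next
  case (add f \<alpha> c)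
  have "((\<lambda>\<tau>. f (x(t := \<tau>)) + power_prod p \<alpha> (x(t := \<tau>)) *\<^sub>R c) has_vector_derivative
      pdiff t f x + power_prod p (\<alpha>(t := \<alpha> t - 1)) x *\<^sub>R (real (\<alpha> t) *\<^sub>R c)) (at (x t))"
    using assms(2) by (intro has_vector_derivative_add add.IH monom_has_derivative)
  then show ?case unfolding pdiff_def using vector_derivative_works differentiableI_vector by blast
qed

lemma pdiff_add:
  assumes "mpoly p d f" "mpoly p d' g" "t \<le> p"
  shows "pdiff t (\<lambda>x. f x + g x) = (\<lambda>x. pdiff t f x + pdiff t g x)"
proof
  fix x
  show "pdiff t (\<lambda>x. f x + g x) x = pdiff t f x + pdiff t g x"
    using has_vector_derivative_add[OF mpoly_pdiff_has_derivative[OF assms(1,3), of x] mpoly_pdiff_has_derivative[OF assms(2,3), of x]]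
    unfolding pdiff_def[of _ "\<lambda>x. f x + g x"] by (rule vector_derivative_at)
qed

lemma pdiff_zero: "pdiff t (\<lambda>x. 0) = (\<lambda>x. 0)"
  by (simp add: pdiff_def fun_eq_iff)

lemma pdiff_sum:
  assumes "finite I" "\<And>i. i \<in> I \<Longrightarrow> mpoly p d (f i)" "t \<le> p"
  shows "pdiff t (\<lambda>x. \<Sum>i\<in>I. f i x) = (\<lambda>x. \<Sum>i\<in>I. pdiff t (f i) x)"
  using assms(1,2)
proof (induction I rule: finite_induct)
  case empty
  then show ?case by (simp add: pdiff_zero)
next
  case (insert i I)
  have "pdiff t (\<lambda>x. f i x + (\<Sum>i\<in>I. f i x)) = (\<lambda>x. pdiff t (f i) x + pdiff t (\<lambda>x. \<Sum>i\<in>I. f i x) x)"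
    using insert assms(3) by (intro pdiff_add mpoly_sum) auto
  then show ?case using insert by simp
qed

lemma pdiff_linear:
  fixes f :: "(nat \<Rightarrow> real) \<Rightarrow> 'a::euclidean_space" and L :: "'a \<Rightarrow> 'a"
  assumes "linear L" "mpoly p d f" "t \<le> p"
  shows "pdiff t (\<lambda>x. L (f x)) = (\<lambda>x. L (pdiff t f x))"
proof
  fix x
  have "bounded_linear L" using assms(1) linear_conv_bounded_linear by blast
  from bounded_linear.has_vector_derivative[OF this mpoly_pdiff_has_derivative[OF assms(2,3), of x]]
  show "pdiff t (\<lambda>x. L (f x)) x = L (pdiff t f x)"
    unfolding pdiff_def[of _ "\<lambda>x. L (f x)"] by (rule vector_derivative_at)
qed

lemma mpoly_pdiff:
  assumes "mpoly p d f" "t \<le> p"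
  shows "mpoly p (d - 1) (pdiff t f)"
  using assms(1)
proof induction
  case zero
  show ?case by (simp add: pdiff_zero mpoly.zero)
next
  case (add f \<alpha> c)
  have eq: "pdiff t (\<lambda>x. f x + power_prod p \<alpha> x *\<^sub>R c) =
      (\<lambda>x. pdiff t f x + power_prod p (\<alpha>(t := \<alpha> t - 1)) x *\<^sub>R (real (\<alpha> t) *\<^sub>R c))"
    by (simp only: pdiff_add[OF add.hyps(1) mpoly_monom[OF add.hyps(2)] assms(2)] pdiff_monom[OF assms(2)])
  have "mpoly p (d - 1) (\<lambda>x. pdiff t f x + power_prod p (\<alpha>(t := \<alpha> t - 1)) x *\<^sub>R (real (\<alpha> t) *\<^sub>R c))"
  \<comment> \<open>If \<open>\<alpha> t = 0\<close>, truncation leaves the exponent as it is, and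
    its degree need not be below \<open>d - 1\<close>; the coefficient 0 removes this
    monomial.\<close>
  proof (cases "\<alpha> t = 0")
    case True
    then show ?thesis using add.IH by simp
  next
    case False
    have "sum (\<alpha>(t := \<alpha> t - 1)) {..p} < sum \<alpha> {..p}"
      using False assms(2) by (intro sum_strict_mono_ex1) auto
    then show ?thesis using add by (intro mpoly.add) auto
  qed
  then show ?case by (simp only: eq)
qed

lemma mpoly_pdiff': "mpoly p d f \<Longrightarrow> t \<le> p \<Longrightarrow> mpoly p d (pdiff t f)"
  using mpoly_pdiff mpoly_mono diff_le_self by blast

lemma pdiff_commute:
  assumes "mpoly p d f" "s \<le> p" "t \<le> p"
  shows "pdiff s (pdiff t f) = pdiff t (pdiff s f)"
  using assms(1)
proof induction
  case zero
  show ?case by (simp add: pdiff_zero)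
next
  case (add f \<alpha> c)
  let ?m = "\<lambda>x. power_prod p \<alpha> x *\<^sub>R c"
  have m: "mpoly p d ?m" by (rule mpoly_monom[OF add.hyps(2)])
  have *: "pdiff t ?m = (\<lambda>x. power_prod p (\<alpha>(t := \<alpha> t - 1)) x *\<^sub>R (real (\<alpha> t) *\<^sub>R c))" if "t \<le> p" for t
    using pdiff_monom[OF that] by blast
  have **: "pdiff s (pdiff t ?m) x = power_prod p (\<alpha>(t := \<alpha> t - 1, s := (\<alpha>(t := \<alpha> t - 1)) s - 1)) x *\<^sub>R
      (real ((\<alpha>(t := \<alpha> t - 1)) s) *\<^sub>R real (\<alpha> t) *\<^sub>R c)" if "s \<le> p" "t \<le> p" for s t x
    using that by (simp only: * pdiff_monom)
  have "pdiff s (pdiff t ?m) = pdiff t (pdiff s ?m)"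
    using assms(2,3) by (cases "s = t") (auto simp: ** fun_upd_twist mult.commute)
  moreover have "pdiff s (pdiff t (\<lambda>x. f x + ?m x)) = (\<lambda>x. pdiff s (pdiff t f) x + pdiff s (pdiff t ?m) x)"
    if "s \<le> p" "t \<le> p" for s t
    using pdiff_add[OF mpoly_pdiff'[OF add.hyps(1) that(2)] mpoly_pdiff'[OF m that(2)] that(1)]
    by (simp only: pdiff_add[OF add.hyps(1) m that(2)])
  ultimately show ?case
    using assms(2,3) add.IH by (simp only:)
qed

text \<open>Passes from the coordinatewise \<open>pdiff\<close> to a total derivative on the
  algebra; \<open>C\<close> will consist of functionals dual to \<open>v\<close>.\<close>

lemma mpoly_pullback_has_derivative:
  fixes C :: "nat \<Rightarrow> 'b::euclidean_space \<Rightarrow> real" and f :: "(nat \<Rightarrow> real) \<Rightarrow> 'a::euclidean_space"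
  assumes C: "\<And>s. linear (C s)" and f: "mpoly p d f"
  shows "((\<lambda>z. f (\<lambda>s. C s z)) has_derivative (\<lambda>h. \<Sum>t\<le>p. C t h *\<^sub>R pdiff t f (\<lambda>s. C s z))) (at z)"
  using f
proof induction
  case zero
  show ?case by (simp add: pdiff_zero)
next
  case (add f \<alpha> c)
  have C': "(C s has_derivative C s) (at z)" for s
    using C linear_imp_has_derivative by blast
  let ?x = "\<lambda>s. C s z"
  have "((\<lambda>z. power_prod p \<alpha> (\<lambda>s. C s z)) has_derivative
     (\<lambda>h. \<Sum>t\<le>p. (real (\<alpha> t) * (C t h * C t z ^ (\<alpha> t - 1))) * (\<Prod>s\<in>{..p} - {t}. C s z ^ \<alpha> s))) (at z)"
    by (intro has_derivative_prod has_derivative_power[OF C', unfolded mult.assoc])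
  then have "((\<lambda>z. power_prod p \<alpha> (\<lambda>s. C s z) *\<^sub>R c) has_derivative
     (\<lambda>h. (\<Sum>t\<le>p. (real (\<alpha> t) * (C t h * C t z ^ (\<alpha> t - 1))) * (\<Prod>s\<in>{..p} - {t}. C s z ^ \<alpha> s)) *\<^sub>R c)) (at z)"
    by (rule has_derivative_scaleR_left)
  also have "(\<lambda>h. (\<Sum>t\<le>p. (real (\<alpha> t) * (C t h * C t z ^ (\<alpha> t - 1))) * (\<Prod>s\<in>{..p} - {t}. C s z ^ \<alpha> s)) *\<^sub>R c) =
     (\<lambda>h. \<Sum>t\<le>p. C t h *\<^sub>R pdiff t (\<lambda>x. power_prod p \<alpha> x *\<^sub>R c) ?x)"
    unfolding scaleR_sum_left
  proof (intro ext sum.cong refl)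
    fix h t assume "t \<in> {..p}"
    then have t: "t \<le> p" by simp
    have "power_prod p (\<alpha>(t := \<alpha> t - 1)) ?x = C t z ^ (\<alpha> t - 1) * (\<Prod>s\<in>{..p} - {t}. C s z ^ \<alpha> s)"
      using t by (subst prod.remove[of _ t]) auto
    then show "(real (\<alpha> t) * (C t h * C t z ^ (\<alpha> t - 1)) * (\<Prod>s\<in>{..p} - {t}. C s z ^ \<alpha> s)) *\<^sub>R c =
      C t h *\<^sub>R pdiff t (\<lambda>x. power_prod p \<alpha> x *\<^sub>R c) ?x"
      by (simp only: pdiff_monom[OF t]) (simp add: mult_ac)
  qed
  finally have "((\<lambda>z. power_prod p \<alpha> (\<lambda>s. C s z) *\<^sub>R c) has_derivative
     (\<lambda>h. \<Sum>t\<le>p. C t h *\<^sub>R pdiff t (\<lambda>x. power_prod p \<alpha> x *\<^sub>R c) ?x)) (at z)" .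
  from has_derivative_add[OF add.IH this]
  show ?case
    by (rule has_derivative_eq_rhs)
      (simp add: pdiff_add[OF add.hyps(1) mpoly_monom[OF add.hyps(2)]] scaleR_add_right sum.distrib)
qed

section \<open>The Laplacian and the Dirac operator on polynomials\<close>

lemma mpoly_lap: "mpoly p d f \<Longrightarrow> mpoly p (d - 1) (\<lambda>x. - lap p f x)"
  unfolding lap_def
  by (rule mpoly_linear[OF linear_uminus mpoly_sum[OF finite_atMost mpoly_pdiff[OF mpoly_pdiff']]]) auto

lemma neg_lap_pow_Suc: "neg_lap_pow p (Suc k) f = (\<lambda>x. - lap p (neg_lap_pow p k f) x)"
  by (simp add: neg_lap_pow_def)

lemma neg_lap_pow_0: "neg_lap_pow p 0 f = f"
  by (simp add: neg_lap_pow_def)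

text \<open>The Laplacian lowers the degree by two; the cruder drop by one per step already brings
  the bound to 0 after \<open>d\<close> steps, which makes the series finite.\<close>

lemma mpoly_neg_lap_pow: "mpoly p d f \<Longrightarrow> mpoly p (d - k) (neg_lap_pow p k f)"
proof (induction k)
  case (Suc k)
  then show ?case using mpoly_lap[of p "d - k"] by (simp add: neg_lap_pow_Suc)
qed (simp add: neg_lap_pow_0)

lemma neg_lap_pow_eq_0: "mpoly p d f \<Longrightarrow> d \<le> k \<Longrightarrow> neg_lap_pow p k f x = 0"
  using mpoly_0[of p] mpoly_neg_lap_pow[of p d f k] by simp

lemma mpoly_dirac:
  fixes f :: "(nat \<Rightarrow> real) \<Rightarrow> 'a::euclidean_space"
  assumes "bilinear mul" "mpoly p d f"
  shows "mpoly p d (dirac mul v p f)"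
  unfolding dirac_def
  using assms by (intro mpoly_sum mpoly_linear[of "mul _"]) (auto intro: mpoly_pdiff' simp: bilinear_def)

text \<open>Left multiplication by the constant \<open>v s\<close> is linear and so commutes with
  partial derivatives; what remains is to permute third derivatives. No product of three algebra
  elements occurs.\<close>

lemma lap_dirac:
  fixes f :: "(nat \<Rightarrow> real) \<Rightarrow> 'a::euclidean_space"
  assumes mul: "bilinear mul" and f: "mpoly p d f"
  shows "(\<lambda>x. - lap p (dirac mul v p f) x) = dirac mul v p (\<lambda>x. - lap p f x)"
proof -
  have lin: "linear (mul w)" for w using mul by (simp add: bilinear_def)
  have 1: "pdiff t (\<lambda>x. \<Sum>s\<le>p. mul (v s) (g s x)) = (\<lambda>x. \<Sum>s\<le>p. mul (v s) (pdiff t (g s) x))"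
    if "t \<le> p" "\<And>s. s \<le> p \<Longrightarrow> mpoly p d (g s)" for t and g :: "nat \<Rightarrow> _"
  proof -
    have "mpoly p d (\<lambda>x. mul (v s) (g s x))" if "s \<in> {..p}" for s
      using mpoly_linear[OF lin \<open>\<And>s. s \<le> p \<Longrightarrow> mpoly p d (g s)\<close>] that by simp
    then have "pdiff t (\<lambda>x. \<Sum>s\<le>p. mul (v s) (g s x)) = (\<lambda>x. \<Sum>s\<le>p. pdiff t (\<lambda>x. mul (v s) (g s x)) x)"
      by (rule pdiff_sum[OF finite_atMost _ that(1)])
    also have "\<dots> = (\<lambda>x. \<Sum>s\<le>p. mul (v s) (pdiff t (g s) x))"
      by (intro ext sum.cong refl) (simp only: pdiff_linear[OF lin that(2) that(1)] atMost_iff)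
    finally show ?thesis .
  qed
  have 2: "pdiff s (\<lambda>x. - (\<Sum>t\<le>p. pdiff t (pdiff t f) x)) x = - (\<Sum>t\<le>p. pdiff t (pdiff t (pdiff s f)) x)"
    if "s \<le> p" for s x
  proof -
    have tt: "mpoly p d (pdiff t (pdiff t f))" if "t \<in> {..p}" for t
      using that by (intro mpoly_pdiff' f) auto
    have "pdiff s (\<lambda>x. - (\<Sum>t\<le>p. pdiff t (pdiff t f) x)) x = - pdiff s (\<lambda>x. \<Sum>t\<le>p. pdiff t (pdiff t f) x) x"
      by (rule fun_cong[OF pdiff_linear[OF linear_uminus mpoly_sum[OF finite_atMost tt] that]])
    also have "\<dots> = - (\<Sum>t\<le>p. pdiff s (pdiff t (pdiff t f)) x)"
      by (simp only: pdiff_sum[OF finite_atMost tt that])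
    also have "pdiff s (pdiff t (pdiff t f)) = pdiff t (pdiff t (pdiff s f))" if t: "t \<le> p" for t
      using pdiff_commute[OF f \<open>s \<le> p\<close> t] pdiff_commute[OF mpoly_pdiff'[OF f t] \<open>s \<le> p\<close> t] by (simp only:)
    then have "- (\<Sum>t\<le>p. pdiff s (pdiff t (pdiff t f)) x) = - (\<Sum>t\<le>p. pdiff t (pdiff t (pdiff s f)) x)"
      by (intro arg_cong[of _ _ uminus] sum.cong refl) (simp only: atMost_iff)
    finally show ?thesis .
  qed
  show ?thesis
  proof
    fix x
    have "lap p (dirac mul v p f) x = (\<Sum>t\<le>p. \<Sum>s\<le>p. mul (v s) (pdiff t (pdiff t (pdiff s f)) x))"
      unfolding lap_def
    proof (intro sum.cong refl)
      fix t assume "t \<in> {..p}"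
      then have t: "t \<le> p" by simp
      have "pdiff t (dirac mul v p f) = (\<lambda>x. \<Sum>s\<le>p. mul (v s) (pdiff t (pdiff s f) x))"
        unfolding dirac_def by (rule 1[OF t mpoly_pdiff'[OF f]])
      moreover have "pdiff t (\<lambda>x. \<Sum>s\<le>p. mul (v s) (pdiff t (pdiff s f) x)) =
          (\<lambda>x. \<Sum>s\<le>p. mul (v s) (pdiff t (pdiff t (pdiff s f)) x))"
        by (rule 1[OF t mpoly_pdiff'[OF mpoly_pdiff'[OF f] t]])
      ultimately show "pdiff t (pdiff t (dirac mul v p f)) x =
          (\<Sum>s\<le>p. mul (v s) (pdiff t (pdiff t (pdiff s f)) x))" by (simp only:)
    qed
    also have "\<dots> = (\<Sum>s\<le>p. \<Sum>t\<le>p. mul (v s) (pdiff t (pdiff t (pdiff s f)) x))"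
      by (rule sum.swap)
    also have "\<dots> = (\<Sum>s\<le>p. mul (v s) (\<Sum>t\<le>p. pdiff t (pdiff t (pdiff s f)) x))"
      by (simp add: linear_sum[OF lin])
    finally show "- lap p (dirac mul v p f) x = dirac mul v p (\<lambda>x. - lap p f x) x"
      unfolding dirac_def lap_def
      by (simp only:) (simp add: 2 linear_neg[OF lin] sum_negf)
  qed
qed

lemma neg_lap_pow_dirac:
  fixes f :: "(nat \<Rightarrow> real) \<Rightarrow> 'a::euclidean_space"
  assumes mul: "bilinear mul" and f: "mpoly p d f"
  shows "neg_lap_pow p k (dirac mul v p f) = dirac mul v p (neg_lap_pow p k f)"
proof (induction k)
  case (Suc k)
  then show ?case
    using lap_dirac[OF mul mpoly_neg_lap_pow[OF f]] by (simp add: neg_lap_pow_Suc)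
qed (simp add: neg_lap_pow_0)

section \<open>The Cauchy problem on a slice\<close>

text \<open>Serves the points of the initial hyperplane, where the cut-off function is bounded by
  the original one and inherits its vanishing difference quotients.\<close>

lemma has_vector_derivative_0_dominated:
  fixes V :: "real \<Rightarrow> 'b::real_normed_vector"
  assumes "(V has_vector_derivative 0) (at 0)" "V 0 = 0" "\<And>t. norm (U t) \<le> norm (V t)"
  shows "(U has_vector_derivative 0) (at 0)"
proof -
  have U0: "U 0 = 0" using assms(2) assms(3)[of 0] by simp
  have "(\<lambda>h. norm (V h) / norm h) \<midarrow>0\<rightarrow> 0"
    using assms(1,2) by (simp add: has_vector_derivative_def has_derivative_at)
  then have "(\<lambda>h. norm (U h) / norm h) \<midarrow>0\<rightarrow> 0"
    by (rule Lim_null_comparison[rotated])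
      (auto intro!: always_eventually divide_right_mono assms(3))
  then show ?thesis
    using U0 by (simp add: has_vector_derivative_def has_derivative_at)
qed

locale partial_slice =
  fixes mul :: "'a::euclidean_space \<Rightarrow> 'a \<Rightarrow> 'a" and e :: 'a and cj :: "'a \<Rightarrow> 'a"
    and v :: "nat \<Rightarrow> 'a" and m p :: nat
  assumes alg: "alt_star_algebra mul e cj"
    and basis: "admissible_basis mul e cj v m"
    and pm: "p < m"
begin

section \<open>Left multiplication and the Clifford relations\<close>

lemma bilinear_mul: "bilinear mul"
  using alg by (simp add: alt_star_algebra_def)

lemma linear_mul: "linear (mul a)"
  using bilinear_mul by (simp add: bilinear_def)

lemmas mul_simps = bilinear_ladd[OF bilinear_mul] bilinear_radd[OF bilinear_mul]
  bilinear_lmul[OF bilinear_mul] bilinear_rmul[OF bilinear_mul]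
  bilinear_lneg[OF bilinear_mul] bilinear_rneg[OF bilinear_mul]
  bilinear_lzero[OF bilinear_mul] bilinear_rzero[OF bilinear_mul]

lemma mul_e: "mul e a = a" "mul a e = a"
  using alg by (auto simp: alt_star_algebra_def)

lemma v0: "v 0 = e"
  using basis by (simp add: admissible_basis_def)

lemma left_alternative: "mul a (mul a w) = mul (mul a a) w"
proof -
  have "associator mul a a w = 0" using alg by (simp add: alt_star_algebra_def)
  then show ?thesis by (simp add: associator_def)
qed

text \<open>Polarisation of the left alternative law. It turns anticommutators of elements into
  anticommutators of left multiplications, which stands in for associativity in the Clifford
  relations.\<close>

lemma left_alternative_linearized: "mul a (mul b w) + mul b (mul a w) = mul (mul a b + mul b a) w"
proof -
  have "mul (a + b) (mul (a + b) w) = mul (mul (a + b) (a + b)) w" by (rule left_alternative)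
  then show ?thesis using left_alternative[of a w] left_alternative[of b w]
    by (simp add: mul_simps algebra_simps)
qed

lemma v_square: "s \<in> {1..m} \<Longrightarrow> mul (v s) (v s) = - e"
proof -
  assume "s \<in> {1..m}"
  then have "trace_alg cj (v s) = 0" "norm_alg mul cj (v s) = e"
    using basis by (auto simp: admissible_basis_def sphere_alg_def)
  then have "cj (v s) = - v s" "mul (v s) (cj (v s)) = e"
    by (auto simp: trace_alg_def norm_alg_def add_eq_0_iff)
  then have "- mul (v s) (v s) = e" by (simp add: mul_simps)
  then show ?thesis by (metis minus_minus)
qed

lemma v_anticommute: "s \<in> {1..m} \<Longrightarrow> t \<in> {1..m} \<Longrightarrow> s \<noteq> t \<Longrightarrow> mul (v s) (v t) = - mul (v t) (v s)"
  using basis unfolding admissible_basis_def by blast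

lemma v_clifford:
  "s \<in> {1..m} \<Longrightarrow> t \<in> {1..m} \<Longrightarrow> mul (v s) (v t) + mul (v t) (v s) = (if s = t then - 2 *\<^sub>R e else 0)"
proof (cases "s = t")
  case True
  assume "s \<in> {1..m}" "t \<in> {1..m}"
  then show ?thesis using v_square[of t] True by (simp add: scaleR_2)
next
  case False
  assume "s \<in> {1..m}" "t \<in> {1..m}"
  from v_anticommute[OF this False] show ?thesis using False by simp
qed

lemma sphere_clifford:
  assumes "\<omega> \<in> slice_sphere v p m"
  shows "mul \<omega> \<omega> = - e" "s \<in> {1..p} \<Longrightarrow> mul (v s) \<omega> + mul \<omega> (v s) = 0"
proof -
  obtain y where \<omega>: "\<omega> = (\<Sum>s\<in>{p+1..m}. y s *\<^sub>R v s)" and y: "(\<Sum>s\<in>{p+1..m}. (y s)\<^sup>2) = 1"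
    using assms by (auto simp: slice_sphere_def)
  let ?I = "{p+1..m}"
  have mr: "mul a \<omega> = (\<Sum>t\<in>?I. y t *\<^sub>R mul a (v t))" for a
    unfolding \<omega> by (simp add: linear_sum[OF linear_mul] mul_simps)
  have "linear (\<lambda>a. mul a b)" for b using bilinear_mul by (simp add: bilinear_def)
  from linear_sum[OF this, of "\<lambda>t. y t *\<^sub>R v t" ?I]
  have ml: "mul \<omega> a = (\<Sum>t\<in>?I. y t *\<^sub>R mul (v t) a)" for a
    unfolding \<omega> by (simp add: mul_simps)
  show "mul (v s) \<omega> + mul \<omega> (v s) = 0" if "s \<in> {1..p}"
  proof -
    have "mul (v s) \<omega> + mul \<omega> (v s) = (\<Sum>t\<in>?I. y t *\<^sub>R (mul (v s) (v t) + mul (v t) (v s)))"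
      unfolding mr ml by (simp add: scaleR_add_right sum.distrib)
    also have "\<dots> = 0"
    proof (intro sum.neutral ballI)
      fix t assume "t \<in> ?I"
      then show "y t *\<^sub>R (mul (v s) (v t) + mul (v t) (v s)) = 0"
        using that pm v_clifford[of s t] by simp
    qed
    finally show ?thesis .
  qed
  have 1: "mul \<omega> \<omega> = (\<Sum>s\<in>?I. \<Sum>t\<in>?I. (y s * y t) *\<^sub>R mul (v s) (v t))"
    unfolding ml by (simp add: mr scaleR_sum_right)
  then have 2: "mul \<omega> \<omega> = (\<Sum>s\<in>?I. \<Sum>t\<in>?I. (y s * y t) *\<^sub>R mul (v t) (v s))"
    by (subst sum.swap) (simp add: mult.commute)
  \<comment> \<open>Adding the double sum to its transpose exposes anticommutators. Only the
    diagonal survives, and its coefficients \<open>(y s)\<^sup>2\<close> sum to 1.\<close>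
  have "mul \<omega> \<omega> + mul \<omega> \<omega> = (\<Sum>s\<in>?I. \<Sum>t\<in>?I. (y s * y t) *\<^sub>R (mul (v s) (v t) + mul (v t) (v s)))"
    by (subst (1) 1, subst (1) 2) (simp add: scaleR_add_right sum.distrib)
  also have "\<dots> = (\<Sum>s\<in>?I. \<Sum>t\<in>?I. if s = t then (y s)\<^sup>2 *\<^sub>R (- 2 *\<^sub>R e) else 0)"
  proof (intro sum.cong refl)
    fix s t assume "s \<in> ?I" "t \<in> ?I"
    then have "s \<in> {1..m}" "t \<in> {1..m}" by auto
    from v_clifford[OF this]
    show "(y s * y t) *\<^sub>R (mul (v s) (v t) + mul (v t) (v s)) = (if s = t then (y s)\<^sup>2 *\<^sub>R (- 2 *\<^sub>R e) else 0)"
      by (simp add: power2_eq_square)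
  qed
  also have "\<dots> = (\<Sum>s\<in>?I. (y s)\<^sup>2 *\<^sub>R (- 2 *\<^sub>R e))"
    by (intro sum.cong refl) (simp add: sum.delta)
  also have "\<dots> = - 2 *\<^sub>R e" by (simp only: scaleR_sum_left[symmetric] y scaleR_one)
  finally have "2 *\<^sub>R mul \<omega> \<omega> = 2 *\<^sub>R (- e)" by (simp add: scaleR_2)
  then show "mul \<omega> \<omega> = - e" by (metis scaleR_left_imp_eq zero_neq_numeral)
qed

lemma mul_sphere_sphere: "\<omega> \<in> slice_sphere v p m \<Longrightarrow> mul \<omega> (mul \<omega> w) = - w"
  by (simp add: left_alternative sphere_clifford mul_simps mul_e)

lemma mul_v_sphere:
  assumes "\<omega> \<in> slice_sphere v p m" "s \<in> {1..p}"
  shows "mul (v s) (mul \<omega> w) = - mul \<omega> (mul (v s) w)"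
  using left_alternative_linearized[of "v s" \<omega> w] sphere_clifford(2)[OF assms]
  by (simp add: mul_simps add_eq_0_iff2)

text \<open>The basis hypothesis concerns a family, whereas \<open>independent\<close> concerns a
  set; a repeated vector would give the nontrivial relation \<open>v s - v t = 0\<close>.\<close>

lemma v_independent: "inj_on v {..m}" "independent (v ` {..m})"
proof -
  have ind: "c s = 0" if "(\<Sum>s\<le>m. c s *\<^sub>R v s) = 0" "s \<le> m" for c s
    using basis that by (auto simp: admissible_basis_def)
  show inj: "inj_on v {..m}"
  proof (rule inj_onI, rule ccontr)
    fix s t assume st: "s \<in> {..m}" "t \<in> {..m}" "v s = v t" "s \<noteq> t"
    have "(\<Sum>i\<le>m. ((if i = s then 1 else 0) - (if i = t then 1 else 0)) *\<^sub>R v i) =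
        (\<Sum>i\<le>m. if i = s then v i else 0) - (\<Sum>i\<le>m. if i = t then v i else 0)"
      unfolding sum_subtractf[symmetric] by (intro sum.cong refl) auto
    also have "\<dots> = 0" using st by (simp add: sum.delta)
    finally have "(if s = s then 1 else 0) - (if s = t then 1 else 0) = (0::real)"
      using st by (intro ind) auto
    then show False using st by simp
  qed
  show "independent (v ` {..m})"
  proof (rule independent_if_scalars_zero)
    fix f x assume f: "(\<Sum>x\<in>v ` {..m}. f x *\<^sub>R x) = 0" and x: "x \<in> v ` {..m}"
    have "(\<Sum>s\<le>m. f (v s) *\<^sub>R v s) = 0" using f by (simp add: sum.reindex[OF inj])
    then show "f x = 0" using ind[of "\<lambda>s. f (v s)"] x by auto
  qed simp
qed

text \<open>The slice has dimension \<open>p + 2\<close>, for which no type is at hand. The difference is therefore pulled back to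
  all of \<open>'a\<close> along a linear map sending basis vectors to \<open>v 0, ..., v p, \<omega>\<close> and the remaining ones to 0,
  and is cut off to 0 on one side of the initial hyperplane. The cut-off is still \<open>C\<^sup>1\<close> because the equation
  makes all first derivatives vanish on the hyperplane.\<close>

lemma slice_eq_if_eq_on_real_part:
  assumes G: "gps_monogenic mul v p m G" and F: "gps_monogenic mul v p m F"
    and eq: "\<And>y. G (\<Sum>s\<le>p. y s *\<^sub>R v s) = F (\<Sum>s\<le>p. y s *\<^sub>R v s)"
    and \<omega>: "\<omega> \<in> slice_sphere v p m" and r: "r > 0"
  shows "G ((\<Sum>s\<le>p. y s *\<^sub>R v s) + r *\<^sub>R \<omega>) = F ((\<Sum>s\<le>p. y s *\<^sub>R v s) + r *\<^sub>R \<omega>)"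
proof -
  let ?S = "slice v p \<omega>"
  obtain DG where DG: "\<And>z. z \<in> ?S \<Longrightarrow> (G has_derivative DG z) (at z within ?S)"
    "\<And>s. s \<le> p \<Longrightarrow> continuous_on ?S (\<lambda>z. DG z (v s))" "continuous_on ?S (\<lambda>z. DG z \<omega>)"
    "\<And>z. z \<in> ?S \<Longrightarrow> (\<Sum>s\<le>p. mul (v s) (DG z (v s))) + mul \<omega> (DG z \<omega>) = 0"
    using G \<omega> unfolding gps_monogenic_def by blast
  obtain DF where DF: "\<And>z. z \<in> ?S \<Longrightarrow> (F has_derivative DF z) (at z within ?S)"
    "\<And>s. s \<le> p \<Longrightarrow> continuous_on ?S (\<lambda>z. DF z (v s))" "continuous_on ?S (\<lambda>z. DF z \<omega>)"
    "\<And>z. z \<in> ?S \<Longrightarrow> (\<Sum>s\<le>p. mul (v s) (DF z (v s))) + mul \<omega> (DF z \<omega>) = 0"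
    using F \<omega> unfolding gps_monogenic_def by blast
  define D where "D z h = DG z h - DF z h" for z h
  have D: "((\<lambda>z. G z - F z) has_derivative D z) (at z within ?S)" if "z \<in> ?S" for z
    unfolding D_def by (intro has_derivative_diff DG DF that)
  \<comment> \<open>Independence of \<open>v 0, ..., v m\<close> gives at least
    \<open>m + 1 \<ge> p + 2\<close> coordinate directions, enough to host
    \<open>v 0, ..., v p\<close> and \<omega>.\<close>
  have "card (v ` {..m}) = Suc m" by (simp add: card_image[OF v_independent(1)])
  then have "card {..Suc p} \<le> card (Basis :: 'a set)"
    using pm independent_card_le[OF v_independent(2)] by simp
  then obtain b :: "nat \<Rightarrow> 'a" where b: "b ` {..Suc p} \<subseteq> Basis" "inj_on b {..Suc p}"
    using card_le_inj[OF finite_atMost finite_Basis] by blast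
  define w where "w s = (if s \<le> p then v s else \<omega>)" for s
  define T where "T z = (\<Sum>s\<le>Suc p. (z \<bullet> b s) *\<^sub>R w s)" for z
  define k where "k = b (Suc p)"
  define J where "J = b ` {..Suc p}"
  have linT: "linear T" unfolding T_def
    by (intro linearI) (simp_all add: inner_add_left scaleR_add_left sum.distrib scaleR_sum_right del: sum.atMost_Suc)
  have bb: "b s \<bullet> b t = (if s = t then 1 else 0)" if "s \<le> Suc p" "t \<le> Suc p" for s t
    using that b inner_Basis[of "b s" "b t"] by (auto simp: inj_on_def image_subset_iff)
  have Tb: "T (b s) = w s" if "s \<le> Suc p" for s
  proof -
    have "T (b s) = (\<Sum>t\<le>Suc p. if t = s then w t else 0)"
      unfolding T_def using that by (intro sum.cong refl) (auto simp: bb)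
    then show ?thesis using that by (simp add: sum.delta)
  qed
  have T0: "T j = 0" if "j \<in> Basis - J" for j
    unfolding T_def using that b by (intro sum.neutral ballI) (auto simp: J_def inner_Basis image_subset_iff)
  have Tz: "T z = (\<Sum>s\<le>p. (z \<bullet> b s) *\<^sub>R v s) + (z \<bullet> k) *\<^sub>R \<omega>" for z
    by (simp add: T_def w_def k_def)
  have TS: "T z \<in> ?S" for z 
    unfolding Tz slice_def
    by (rule CollectI, rule exI[of _ "\<lambda>s. z \<bullet> b s"], rule exI[of _ "z \<bullet> k"]) simp
  have kB: "k \<in> Basis" using b by (auto simp: k_def)
  define V where "V z = G (T z) - F (T z)" for z
  define d where "d j z = D (T z) (T j)" for j z
  have bD: "bounded_linear (D (T z))" for z using D[OF TS] by (rule has_derivative_bounded_linear)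
  have V: "(V has_derivative (\<lambda>h. D (T z) (T h))) (at z)" for z
  proof -
    have "(T has_derivative T) (at z)" by (rule linear_imp_has_derivative[OF linT])
    \<comment> \<open>All values of \<open>T\<close> lie in the slice, so a derivative within the
      slice yields a derivative of \<open>V\<close> in the full space.\<close>
    moreover have "((\<lambda>z. G z - F z) has_derivative D (T z)) (at (T z) within range T)"
      by (rule has_derivative_subset[OF D[OF TS]]) (use TS in auto)
    ultimately show ?thesis unfolding V_def by (rule has_derivative_in_compose)
  qed
  have Vline: "((\<lambda>t. V (z + t *\<^sub>R j)) has_vector_derivative d j z) (at 0)" for z j
  proof -
    have "((\<lambda>t. z + t *\<^sub>R j) has_derivative (\<lambda>t. t *\<^sub>R j)) (at (0::real))"
      by (auto intro!: derivative_eq_intros)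
    moreover have "(V has_derivative (\<lambda>h. D (T z) (T h))) (at (z + 0 *\<^sub>R j))" using V[of z] by simp
    ultimately have "((\<lambda>t. V (z + t *\<^sub>R j)) has_derivative (\<lambda>t. D (T z) (T (t *\<^sub>R j)))) (at 0)"
      by (rule has_derivative_compose)
    moreover have "D (T z) (T (t *\<^sub>R j)) = t *\<^sub>R d j z" for t
      unfolding d_def by (simp add: linear_cmul[OF linT] linear_cmul[OF bounded_linear.linear[OF bD]])
    ultimately show ?thesis by (simp add: has_vector_derivative_def)
  qed
  have d0: "d j z = 0" if "j \<in> Basis - J" for j z
    unfolding d_def T0[OF that] by (rule linear_0[OF bounded_linear.linear[OF bD]])
  have cT: "continuous_on UNIV T" using linT linear_continuous_on linear_conv_bounded_linear by blast
  have cD: "continuous_on ?S (\<lambda>z. D z (w s))" for s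
    unfolding D_def w_def by (auto intro!: continuous_intros DG DF)
  have cd: "continuous_on UNIV (d j)" if "j \<in> Basis" for j
  proof (cases "j \<in> J")
    case True
    then obtain s where s: "s \<le> Suc p" "j = b s" by (auto simp: J_def)
    have "continuous_on UNIV (\<lambda>z. D (T z) (w s))"
      by (rule continuous_on_compose2[OF cD cT]) (use TS in auto)
    then show ?thesis by (simp add: d_def s Tb)
  next
    case False
    then have "d j = (\<lambda>z. 0)" using d0 that by blast
    then show ?thesis by simp
  qed
  have Sd: "(\<Sum>j\<in>J. mul (T j) (d j z)) = (\<Sum>s\<le>p. mul (v s) (d (b s) z)) + mul \<omega> (d k z)" for z
  proof -
    have "(\<Sum>j\<in>J. mul (T j) (d j z)) = (\<Sum>s\<le>Suc p. mul (w s) (d (b s) z))"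
      unfolding J_def by (simp only: sum.reindex[OF b(2)] o_def) (intro sum.cong refl, simp add: Tb)
    then show ?thesis by (simp add: w_def k_def)
  qed
  have eqn: "(\<Sum>j\<in>J. mul (T j) (d j z)) = 0" for z
  proof -
    have "(\<Sum>s\<le>p. mul (v s) (d (b s) z)) + mul \<omega> (d k z) =
       ((\<Sum>s\<le>p. mul (v s) (DG (T z) (v s))) + mul \<omega> (DG (T z) \<omega>)) -
       ((\<Sum>s\<le>p. mul (v s) (DF (T z) (v s))) + mul \<omega> (DF (T z) \<omega>))"
      by (simp add: d_def Tb w_def k_def D_def linear_diff[OF linear_mul] sum_subtractf)
    then show ?thesis using DG(4)[OF TS] DF(4)[OF TS] by (simp add: Sd)
  qed
  have V0: "V z = 0" if "z \<bullet> k = 0" for z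
    unfolding V_def Tz that using eq by simp
  have dz: "d j z = 0" if "j \<in> Basis" "z \<bullet> k = 0" for j z
  proof -
    have *: "d (b s) z = 0" if "s \<le> p" for s
    proof -
      have "V (z + t *\<^sub>R b s) = 0" for t
        using that bb[of s "Suc p"] \<open>z \<bullet> k = 0\<close> by (intro V0) (simp add: inner_add_left k_def)
      then have "((\<lambda>t. 0::'a) has_vector_derivative d (b s) z) (at (0::real))"
        using Vline[of z "b s"] by simp
      then show ?thesis using vector_derivative_unique_at has_vector_derivative_const by blast
    qed
    then have "(\<Sum>s\<le>p. mul (v s) (d (b s) z)) = 0" by (intro sum.neutral) (simp add: mul_simps)
    then have "mul \<omega> (d k z) = 0" using eqn[of z] Sd[of z] by simp
    \<comment> \<open>Left multiplication by \<omega> is injective, since applying it twice changes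
      the sign.\<close>
    then have "d k z = 0" using mul_sphere_sphere[OF \<omega>, of "d k z"] by (simp add: mul_simps)
    then have "d j z = 0" if "j \<in> J"
      using that * unfolding J_def k_def by (auto simp: le_Suc_eq)
    then show ?thesis using d0 that by blast
  qed
  \<comment> \<open>The side \<open>z \<bullet> k > 0\<close> is kept because the point to be
    reached has \<open>r > 0\<close>.\<close>
  define U where "U z = (if z \<bullet> k > 0 then V z else 0)" for z
  define d' where "d' j z = (if z \<bullet> k > 0 then d j z else 0)" for j z
  have cV: "continuous_on UNIV V"
    by (rule has_derivative_continuous_on[OF has_derivative_at_withinI[OF V]])
  have cut: "continuous_on UNIV (\<lambda>z. if z \<bullet> k > 0 then f z else 0)"
    if f: "continuous_on UNIV f" "\<And>z. z \<bullet> k = 0 \<Longrightarrow> f z = 0" for f :: "'a \<Rightarrow> 'a"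
  proof -
    have "continuous_on ({z. z \<bullet> k \<ge> 0} \<union> {z. z \<bullet> k \<le> 0}) (\<lambda>z. if z \<bullet> k > 0 then f z else 0)"
    proof (rule continuous_on_If)
      show "closed {z. z \<bullet> k \<ge> 0}" "closed {z. z \<bullet> k \<le> 0}"
        by (intro closed_Collect_le continuous_intros)+
      show "continuous_on {z. z \<bullet> k \<ge> 0} f" by (rule continuous_on_subset[OF f(1)]) simp
      show "continuous_on {z. z \<bullet> k \<le> 0} (\<lambda>z. 0)" by simp
      show "f z = 0" if "z \<in> {z. z \<bullet> k \<ge> 0}" "\<not> z \<bullet> k > 0" for z using that by (intro f(2)) simp
      show "f z = 0" if "z \<in> {z. z \<bullet> k \<le> 0}" "z \<bullet> k > 0" for z using that by simp
    qed
    moreover have "{z. z \<bullet> k \<ge> 0} \<union> {z. z \<bullet> k \<le> 0} = UNIV" by auto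
    ultimately show ?thesis by simp
  qed
  have der: "((\<lambda>t. U (z + t *\<^sub>R j)) has_vector_derivative d' j z) (at 0)" if j: "j \<in> Basis" for j z
  proof -
    consider "z \<bullet> k > 0" | "z \<bullet> k < 0" | "z \<bullet> k = 0" by linarith
    then show ?thesis
    proof cases
      case 1
      have "open {t. (z + t *\<^sub>R j) \<bullet> k > 0}" by (intro open_Collect_less continuous_intros)
      from has_vector_derivative_transform_within_open[OF Vline[of z j] this, of "\<lambda>t. U (z + t *\<^sub>R j)"]
      show ?thesis using 1 by (simp add: U_def d'_def)
    next
      case 2
      have "open {t. (z + t *\<^sub>R j) \<bullet> k < 0}" by (intro open_Collect_less continuous_intros)
      from has_vector_derivative_transform_within_open[OF has_vector_derivative_const[of 0] this, of 0 "\<lambda>t. U (z + t *\<^sub>R j)"]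
      show ?thesis using 2 by (simp add: U_def d'_def)
    next
      case 3
      have "((\<lambda>t. U (z + t *\<^sub>R j)) has_vector_derivative 0) (at 0)"
        by (rule has_vector_derivative_0_dominated[where V = "\<lambda>t. V (z + t *\<^sub>R j)"])
          (use Vline[of z j] dz[OF j 3] V0[OF 3] in \<open>auto simp: U_def\<close>)
      then show ?thesis using 3 by (simp add: d'_def)
    qed
  qed
  have Uz: "U z = 0" for z
  proof (rule elliptic_system_unique_continuation[where U = U and z = z and J = J and u = "b 0" and L = "\<lambda>j. mul (T j)"
        and d = d' and H = "{z. z \<bullet> k < 0}"])
    show "J \<subseteq> Basis" using b by (simp add: J_def)
    show "b 0 \<in> J" by (simp add: J_def)
    show "linear (mul (T j))" for j by (rule linear_mul)
    \<comment> \<open>The vector \<open>b 0\<close> is sent to the unity, so it is the distinguished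
      direction whose operator is the identity.\<close>
    show "mul (T (b 0)) w = w" for w by (simp add: Tb w_def v0 mul_e)
    show "mul (T i) (mul (T j) x) + mul (T j) (mul (T i) x) = (if i = j then - 2 *\<^sub>R x else 0)"
      if iJ: "i \<in> J - {b 0}" and jJ: "j \<in> J - {b 0}" for i j x
    proof -
      have ex: "\<exists>s\<in>{1..Suc p}. i = b s" if i: "i \<in> J - {b 0}" for i
      proof -
        obtain s where s: "s \<le> Suc p" "i = b s" using i by (auto simp: J_def)
        with i have "s \<noteq> 0" by (metis DiffE insertI1)
        with s show ?thesis by (intro bexI[of _ s]) auto
      qed
      obtain s t where st: "s \<in> {1..Suc p}" "t \<in> {1..Suc p}" "i = b s" "j = b t"
        using ex[OF iJ] ex[OF jJ] by blast
      have ij: "i = j \<longleftrightarrow> s = t"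
        using st inj_on_eq_iff[OF b(2), of s t] by simp
      have "mul (w s) (w t) + mul (w t) (w s) = (if s = t then - 2 *\<^sub>R e else 0)"
      proof (cases "s \<le> p"; cases "t \<le> p")
        assume "s \<le> p" "t \<le> p"
        then have "s \<in> {1..m}" "t \<in> {1..m}" using st pm by auto
        from v_clifford[OF this] show ?thesis using \<open>s \<le> p\<close> \<open>t \<le> p\<close> by (simp only: w_def if_True)
      next
        assume a: "s \<le> p" "\<not> t \<le> p"
        then have "s \<in> {1..p}" "s \<noteq> t" using st by auto
        with a sphere_clifford(2)[OF \<omega>, of s] show ?thesis by (simp only: w_def if_True if_False)
      next
        assume a: "\<not> s \<le> p" "t \<le> p"
        then have "t \<in> {1..p}" "s \<noteq> t" using st by auto
        with a sphere_clifford(2)[OF \<omega>, of t] show ?thesis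
          by (simp only: w_def if_True if_False add.commute[of "mul \<omega> _"])
      next
        assume a: "\<not> s \<le> p" "\<not> t \<le> p"
        then have "s = t" using st by auto
        with a sphere_clifford(1)[OF \<omega>] show ?thesis by (simp add: w_def scaleR_2)
      qed
      then show ?thesis
        using st unfolding left_alternative_linearized ij by (simp add: Tb mul_simps mul_e)
    qed
    show "continuous_on UNIV U" unfolding U_def by (rule cut[OF cV V0])
    show "continuous_on UNIV (d' j)" if "j \<in> Basis" for j
      unfolding d'_def[abs_def] by (rule cut[OF cd[OF that] dz[OF that]])
    show "((\<lambda>t. U (z + t *\<^sub>R j)) has_vector_derivative d' j z) (at 0)" if "j \<in> Basis" for j z
      by (rule der[OF that])
    show "d' j z = 0" if "j \<in> Basis - J" for j z using d0[OF that] by (simp add: d'_def)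
    show "(\<Sum>j\<in>J. mul (T j) (d' j z)) = 0" for z
      using eqn[of z] by (cases "z \<bullet> k > 0") (simp_all add: d'_def mul_simps)
    show "open {z. z \<bullet> k < 0}" by (intro open_Collect_less continuous_intros)
    have "- k \<in> {z. z \<bullet> k < 0}" using kB by simp
    then show "{z. z \<bullet> k < 0} \<noteq> {}" by blast
    show "U z = 0" if "z \<in> {z. z \<bullet> k < 0}" for z using that by (simp add: U_def)
  qed
  define z where "z = (\<Sum>s\<le>p. y s *\<^sub>R b s) + r *\<^sub>R k"
  have zb: "z \<bullet> b t = y t" if "t \<le> p" for t
  proof -
    have "z \<bullet> b t = (\<Sum>s\<le>p. if s = t then y s else 0)"
      unfolding z_def using that by (simp add: inner_add_left inner_sum_left k_def bb if_distrib cong: if_cong)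
    then show ?thesis using that by (simp add: sum.delta)
  qed
  have zk: "z \<bullet> k = r"
    unfolding z_def by (simp add: inner_add_left inner_sum_left k_def bb)
  have "T z = (\<Sum>s\<le>p. y s *\<^sub>R v s) + r *\<^sub>R \<omega>"
    unfolding Tz zk by (simp add: zb)
  moreover have "V z = 0" using Uz[of z] r by (simp add: U_def zk)
  ultimately show ?thesis by (simp add: V_def)
qed

section \<open>The extension series on a slice\<close>

lemma coordinates:
  "\<exists>c :: nat \<Rightarrow> 'a \<Rightarrow> real. (\<forall>s. linear (c s)) \<and>
     (\<forall>s t. s \<le> m \<longrightarrow> t \<le> m \<longrightarrow> c s (v t) = (if s = t then 1 else 0))"
proof -
  have "\<exists>g :: 'a \<Rightarrow> real. linear g \<and> (\<forall>x\<in>v ` {..m}. g x = (if x = v s then 1 else 0))" for s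
    by (rule linear_independent_extend[OF v_independent(2)])
  then obtain c :: "nat \<Rightarrow> 'a \<Rightarrow> real" where c: "\<And>s. linear (c s)"
    "\<And>s x. x \<in> v ` {..m} \<Longrightarrow> c s x = (if x = v s then 1 else 0)" by metis
  have "c s (v t) = (if s = t then 1 else 0)" if "s \<le> m" "t \<le> m" for s t
    using c(2)[of "v t" s] that inj_on_eq_iff[OF v_independent(1), of s t] by auto
  with c(1) show ?thesis by blast
qed

text \<open>Polynomials read only the coordinates up to \<open>p\<close>, so the truncated point
  inside \<open>CK\<close> may be replaced by \<open>y\<close>, and the terms from \<open>d\<close>
  on are 0.\<close>

lemma CK_eq_finite_sum:
  assumes f0: "mpoly p d f0" and d: "d \<le> N"
    and r: "r = sqrt (\<Sum>s\<in>{p+1..m}. (y s)\<^sup>2)"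
  shows "CK mul v p m f0 y =
    (\<Sum>k<N. (r ^ (2*k) / fact (2*k)) *\<^sub>R neg_lap_pow p k f0 y) +
    mul ((1 / r) *\<^sub>R (\<Sum>s\<in>{p+1..m}. y s *\<^sub>R v s))
      (\<Sum>k<N. (r ^ (2*k+1) / fact (2*k+1)) *\<^sub>R neg_lap_pow p k (dirac mul v p f0) y)"
proof -
  have *: "(\<Sum>k. a k *\<^sub>R neg_lap_pow p k g (\<lambda>s. if s \<le> p then y s else 0)) = (\<Sum>k<N. a k *\<^sub>R neg_lap_pow p k g y)"
    if g: "mpoly p d g" for g :: "(nat \<Rightarrow> real) \<Rightarrow> 'a" and a
  proof -
    have "(\<Sum>k. a k *\<^sub>R neg_lap_pow p k g (\<lambda>s. if s \<le> p then y s else 0)) =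
        (\<Sum>k<N. a k *\<^sub>R neg_lap_pow p k g (\<lambda>s. if s \<le> p then y s else 0))"
      by (rule suminf_finite) (use neg_lap_pow_eq_0[OF g] d in auto)
    also have "\<dots> = (\<Sum>k<N. a k *\<^sub>R neg_lap_pow p k g y)"
      by (intro sum.cong refl arg_cong[of _ _ "scaleR _"] mpoly_cong[OF mpoly_neg_lap_pow[OF g]]) simp
    finally show ?thesis .
  qed
  show ?thesis
    unfolding CK_def Let_def r[symmetric] *[OF f0] *[OF mpoly_dirac[OF bilinear_mul f0]] by (rule refl)
qed

text \<open>Here \<open>r\<close> may be negative or zero: the series is unchanged when the signs of \<open>r\<close> and of the unit vector
  are flipped together, and at \<open>r = 0\<close> the junk value \<open>(1 / 0) *\<^sub>R 0\<close> is multiplied by 0.\<close>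

lemma CK_on_slice:
  assumes f0: "mpoly p d f0" "d \<le> N"
    and w: "(\<Sum>s\<in>{p+1..m}. (w s)\<^sup>2) = 1" and y: "\<And>s. s \<in> {p+1..m} \<Longrightarrow> y s = r * w s"
  shows "CK mul v p m f0 y =
    (\<Sum>k<N. (r ^ (2*k) / fact (2*k)) *\<^sub>R neg_lap_pow p k f0 y) +
    mul (\<Sum>s\<in>{p+1..m}. w s *\<^sub>R v s)
      (\<Sum>k<N. (r ^ (2*k+1) / fact (2*k+1)) *\<^sub>R neg_lap_pow p k (dirac mul v p f0) y)"
proof -
  let ?B = "\<lambda>k. neg_lap_pow p k (dirac mul v p f0) y"
  let ?\<omega> = "\<Sum>s\<in>{p+1..m}. w s *\<^sub>R v s"
  have "(\<Sum>s\<in>{p+1..m}. (y s)\<^sup>2) = (\<Sum>s\<in>{p+1..m}. r\<^sup>2 * (w s)\<^sup>2)"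
    by (intro sum.cong refl) (simp only: y power_mult_distrib)
  also have "\<dots> = r\<^sup>2" by (simp only: sum_distrib_left[symmetric] w mult_1_right)
  finally have r: "\<bar>r\<bar> = sqrt (\<Sum>s\<in>{p+1..m}. (y s)\<^sup>2)" by simp
  have "(\<Sum>s\<in>{p+1..m}. y s *\<^sub>R v s) = (\<Sum>s\<in>{p+1..m}. r *\<^sub>R w s *\<^sub>R v s)"
    by (intro sum.cong refl) (simp only: y scaleR_scaleR)
  then have \<omega>: "(\<Sum>s\<in>{p+1..m}. y s *\<^sub>R v s) = r *\<^sub>R ?\<omega>"
    by (simp only: scaleR_sum_right)
  have move: "mul (a *\<^sub>R b *\<^sub>R x) z = mul x ((a * b) *\<^sub>R z)" for a b x z
    by (simp add: mul_simps)
  have coeff: "(1 / \<bar>r\<bar>) * r * (\<bar>r\<bar> ^ (2*k+1) / fact (2*k+1)) = r ^ (2*k+1) / fact (2*k+1)" for k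
  proof (cases "r = 0")
    case False
    have "\<bar>r\<bar> ^ (2*k+1) = \<bar>r\<bar> * r ^ (2*k)" by (simp add: power_even_abs)
    with False show ?thesis by simp
  qed simp
  have 1: "mul ((1 / \<bar>r\<bar>) *\<^sub>R r *\<^sub>R ?\<omega>) (\<Sum>k<N. (\<bar>r\<bar> ^ (2*k+1) / fact (2*k+1)) *\<^sub>R ?B k) =
      mul ?\<omega> (\<Sum>k<N. (r ^ (2*k+1) / fact (2*k+1)) *\<^sub>R ?B k)"
    unfolding move by (simp only: scaleR_sum_right scaleR_scaleR coeff)
  have "\<bar>r\<bar> ^ (2*k) = r ^ (2*k)" for k by (simp add: power_even_abs)
  then show ?thesis
    unfolding CK_eq_finite_sum[OF f0 r] \<omega> 1 by simp
qed

text \<open>Moving \<omega> to the left changes the sign of every term except that of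
  \<open>v 0\<close>, which turns the outer Dirac operator into its conjugate. Then
  \<open>clifford_factorisation\<close> applies with the second derivatives of \<open>f\<close> as
  the matrix.\<close>

lemma conjugate_dirac_dirac:
  assumes f: "mpoly p d f" and \<omega>: "\<omega> \<in> slice_sphere v p m"
  shows "(\<Sum>s\<le>p. mul (v s) (mul \<omega> (pdiff s (dirac mul v p f) x))) = mul \<omega> (lap p f x)"
proof -
  define X where "X i = (\<Sum>j\<le>p. mul (v j) (pdiff i (pdiff j f) x))" for i
  have X: "pdiff i (dirac mul v p f) x = X i" if "i \<le> p" for i
  proof -
    have "mpoly p d (\<lambda>x. mul (v j) (pdiff j f x))" if "j \<in> {..p}" for j
      using mpoly_linear[OF linear_mul mpoly_pdiff'[OF f]] that by simp
    then have "pdiff i (dirac mul v p f) x = (\<Sum>j\<le>p. pdiff i (\<lambda>x. mul (v j) (pdiff j f x)) x)"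
      unfolding dirac_def by (subst pdiff_sum[OF finite_atMost _ that]) auto
    also have "\<dots> = X i"
      unfolding X_def
    proof (intro sum.cong refl)
      fix j assume "j \<in> {..p}"
      then show "pdiff i (\<lambda>x. mul (v j) (pdiff j f x)) x = mul (v j) (pdiff i (pdiff j f) x)"
        using pdiff_linear[OF linear_mul mpoly_pdiff'[OF f] that, of j "v j"] by simp
    qed
    finally show ?thesis .
  qed
  have "(\<Sum>j\<le>p. mul (v j) (pdiff 0 (pdiff j f) x)) - (\<Sum>i\<in>{..p} - {0}. mul (v i) (\<Sum>j\<le>p. mul (v j) (pdiff i (pdiff j f) x))) =
      (\<Sum>j\<le>p. pdiff j (pdiff j f) x)"
  proof (rule clifford_factorisation[where L = "\<lambda>j. mul (v j)"])
    show "mul (v i) (mul (v j) w) + mul (v j) (mul (v i) w) = (if i = j then - 2 *\<^sub>R w else 0)"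
      if "i \<in> {..p} - {0}" "j \<in> {..p} - {0}" for i j w
    proof -
      have "i \<in> {1..m}" "j \<in> {1..m}" using that pm by auto
      from v_clifford[OF this] show ?thesis
        unfolding left_alternative_linearized by (simp add: mul_simps mul_e)
    qed
    show "pdiff i (pdiff j f) x = pdiff j (pdiff i f) x" if "i \<in> {..p}" "j \<in> {..p}" for i j
      using pdiff_commute[OF f, of i j] that by simp
  qed (auto simp: linear_mul v0 mul_e)
  then have lap: "X 0 - (\<Sum>i\<in>{..p} - {0}. mul (v i) (X i)) = lap p f x"
    by (simp only: X_def lap_def)
  have "(\<Sum>s\<le>p. mul (v s) (mul \<omega> (pdiff s (dirac mul v p f) x))) = (\<Sum>s\<le>p. mul (v s) (mul \<omega> (X s)))"
    by (intro sum.cong refl) (simp add: X)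
  also have "\<dots> = mul \<omega> (X 0) + (\<Sum>s\<in>{..p} - {0}. mul (v s) (mul \<omega> (X s)))"
    by (subst sum.remove[of _ 0]) (simp_all add: v0 mul_e)
  also have "(\<Sum>s\<in>{..p} - {0}. mul (v s) (mul \<omega> (X s))) = (\<Sum>s\<in>{..p} - {0}. - mul \<omega> (mul (v s) (X s)))"
    by (intro sum.cong refl mul_v_sphere \<omega>) auto
  also have "\<dots> = - mul \<omega> (\<Sum>s\<in>{..p} - {0}. mul (v s) (X s))"
    by (simp add: sum_negf linear_sum[OF linear_mul])
  also have "mul \<omega> (X 0) + \<dots> = mul \<omega> (lap p f x)"
    by (simp add: lap[symmetric] linear_diff[OF linear_mul])
  finally show ?thesis .
qed

lemma CK_monogenic:
  assumes f0: "mpoly p d f0"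
    and c: "\<And>s. linear (c s)" "\<And>s t. s \<le> m \<Longrightarrow> t \<le> m \<Longrightarrow> c s (v t) = (if s = t then 1 else 0)"
  shows "gps_monogenic mul v p m (\<lambda>z. CK mul v p m f0 (\<lambda>s. c s z))"
  unfolding gps_monogenic_def
proof
  fix \<omega> assume \<omega>: "\<omega> \<in> slice_sphere v p m"
  then obtain w where w: "\<omega> = (\<Sum>s\<in>{p+1..m}. w s *\<^sub>R v s)" "(\<Sum>s\<in>{p+1..m}. (w s)\<^sup>2) = 1"
    by (auto simp: slice_sphere_def)
  let ?S = "slice v p \<omega>"
  define N where "N = d"
  define A where "A k = neg_lap_pow p k f0" for k
  define B where "B k = neg_lap_pow p k (dirac mul v p f0)" for k
  \<comment> \<open>On this slice \<rho> is the signed radius \<open>r\<close>. Being linear, it is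
    smooth through \<open>r = 0\<close>, unlike the absolute value.\<close>
  define \<rho> where "\<rho> z = (\<Sum>s\<in>{p+1..m}. w s * c s z)" for z
  define C where "C z = (\<lambda>s. c s z)" for z
  define E where "E j z = \<rho> z ^ j / fact j" for j z
  \<comment> \<open>This is the derivative of \<open>E j\<close> with respect to \<rho>; without the
    separate case, the truncated \<open>0 - 1\<close> would give the derivative of a constant as
    \<open>E 0 = 1\<close>.\<close>
  define E' where "E' j z = (if j = 0 then 0 else E (j - 1) z)" for j z
  have A: "mpoly p d (A k)" for k
    unfolding A_def using mpoly_mono[OF mpoly_neg_lap_pow[OF f0]] by simp
  have B: "mpoly p d (B k)" for k
    unfolding B_def using mpoly_mono[OF mpoly_neg_lap_pow[OF mpoly_dirac[OF bilinear_mul f0]]] by simp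
  have BA: "B k = dirac mul v p (A k)" for k
    unfolding A_def B_def by (rule neg_lap_pow_dirac[OF bilinear_mul f0])
  have AN: "A N x = 0" for x unfolding A_def N_def by (rule neg_lap_pow_eq_0[OF f0 order_refl])
  have lapA: "lap p (A k) x = - A (Suc k) x" for k x
    unfolding A_def by (simp add: neg_lap_pow_Suc)
  have lin\<rho>: "linear \<rho>"
    unfolding \<rho>_def by (intro linearI)
      (simp_all add: linear_add[OF c(1)] linear_cmul[OF c(1)] distrib_left sum.distrib sum_distrib_left mult_ac)
  have cv: "c t (v s) = (if t = s then 1 else 0)" if "t \<le> p" "s \<le> p" for s t
    using that pm c(2) by simp
  have c\<omega>: "c t \<omega> = (if t \<in> {p+1..m} then w t else 0)" if "t \<le> m" for t
  proof -
    have "c t \<omega> = (\<Sum>s\<in>{p+1..m}. w s * c t (v s))"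
      unfolding w by (simp add: linear_sum[OF c(1)] linear_cmul[OF c(1)])
    also have "\<dots> = (\<Sum>s\<in>{p+1..m}. if s = t then w s else 0)"
      using that by (intro sum.cong refl) (auto simp: c(2))
    finally have "c t \<omega> = \<dots>" .
    then show ?thesis by (simp add: sum.delta)
  qed
  have \<rho>v: "\<rho> (v s) = 0" if "s \<le> p" for s
    unfolding \<rho>_def using that pm c(2) by (intro sum.neutral) auto
  have \<rho>\<omega>: "\<rho> \<omega> = 1"
  proof -
    have "\<rho> \<omega> = (\<Sum>s\<in>{p+1..m}. (w s)\<^sup>2)"
      unfolding \<rho>_def by (intro sum.cong refl) (simp add: c\<omega> power2_eq_square)
    then show ?thesis by (simp only: w(2))
  qed
  \<comment> \<open>For fixed \<omega> this is polynomial in the coordinates, hence differentiable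
    on the whole algebra, and it agrees with \<open>CK\<close> on the slice of \<omega>.\<close>
  define P where "P z = (\<Sum>k<N. E (2*k) z *\<^sub>R A k (C z)) + mul \<omega> (\<Sum>k<N. E (2*k+1) z *\<^sub>R B k (C z))" for z
  have CK: "CK mul v p m f0 (\<lambda>s. c s z) = P z" if zS: "z \<in> ?S" for z
  proof -
    obtain y r where z: "z = (\<Sum>s\<le>p. y s *\<^sub>R v s) + r *\<^sub>R \<omega>" using zS by (auto simp: slice_def)
    have "c t z = r * w t" if t: "t \<in> {p+1..m}" for t
    proof -
      have "(\<Sum>s\<le>p. y s * c t (v s)) = 0" using t pm c(2) by (intro sum.neutral) auto
      then show ?thesis using t
        unfolding z by (simp add: linear_add[OF c(1)] linear_sum[OF c(1)] linear_cmul[OF c(1)] c\<omega>)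
    qed
    moreover have "\<rho> z = r"
      unfolding z using \<rho>v by (simp add: linear_add[OF lin\<rho>] linear_sum[OF lin\<rho>] linear_cmul[OF lin\<rho>] \<rho>\<omega>)
    ultimately show ?thesis
      unfolding P_def E_def A_def B_def C_def w(1)
      by (simp only: CK_on_slice[OF f0 order_refl w(2), of "\<lambda>s. c s z" r] N_def)
  qed
  define Q where "Q f z h = (\<Sum>t\<le>p. c t h *\<^sub>R pdiff t f (C z))" for f :: "(nat \<Rightarrow> real) \<Rightarrow> 'a" and z h
  have Q: "((\<lambda>z. f (C z)) has_derivative Q f z) (at z)" if "mpoly p d f" for f z
    unfolding C_def Q_def by (rule mpoly_pullback_has_derivative[OF c(1) that])
  have Qc: "continuous_on UNIV (\<lambda>z. f (C z))" if "mpoly p d f" for f :: "(nat \<Rightarrow> real) \<Rightarrow> 'a"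
    using has_derivative_continuous_on[OF has_derivative_at_withinI[OF Q[OF that]]] by blast
  have E: "(E j has_derivative (\<lambda>h. E' j z * \<rho> h)) (at z)" for j z
  proof (cases j)
    case 0
    then show ?thesis by (simp add: E_def[abs_def] E'_def)
  next
    case (Suc i)
    have eq: "(real (Suc i) * x ^ i) / fact (Suc i) = x ^ i / fact i" for x :: real
      unfolding fact_Suc by (simp del: of_nat_Suc)
    have "((\<lambda>x::real. x ^ Suc i / fact (Suc i)) has_real_derivative (real (Suc i) * x ^ i) / fact (Suc i)) (at x)" for x
      by (rule DERIV_cdivide) (use DERIV_pow[of "Suc i" x] in \<open>simp only: diff_Suc_Suc diff_zero\<close>)
    then have "((\<lambda>x::real. x ^ Suc i / fact (Suc i)) has_real_derivative x ^ i / fact i) (at x)" for x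
      unfolding eq .
    from DERIV_compose_FDERIV[OF this linear_imp_has_derivative[OF lin\<rho>], of z]
    show ?thesis by (simp add: E_def[abs_def] E'_def Suc mult.commute)
  qed
  have Ec: "continuous_on UNIV (E j)" for j
    using has_derivative_continuous_on[OF has_derivative_at_withinI[OF E]] by blast
  have E'c: "continuous_on UNIV (E' j)" for j
    unfolding E'_def[abs_def] by (cases "j = 0") (simp_all add: Ec)
  define D where "D z h = (\<Sum>k<N. E (2*k) z *\<^sub>R Q (A k) z h + (E' (2*k) z * \<rho> h) *\<^sub>R A k (C z)) +
     mul \<omega> (\<Sum>k<N. E (2*k+1) z *\<^sub>R Q (B k) z h + (E' (2*k+1) z * \<rho> h) *\<^sub>R B k (C z))" for z h
  have blm: "bounded_linear (mul \<omega>)" using linear_mul linear_conv_bounded_linear by blast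
  have D: "(P has_derivative D z) (at z)" for z
    unfolding P_def[abs_def] D_def[abs_def]
    by (intro has_derivative_add has_derivative_sum has_derivative_scaleR
        bounded_linear.has_derivative[OF blm] E Q A B)
  have Qv: "Q f z (v s) = pdiff s f (C z)" if "s \<le> p" for f z s
  proof -
    have "Q f z (v s) = (\<Sum>t\<le>p. if t = s then pdiff t f (C z) else 0)"
      unfolding Q_def using that by (intro sum.cong refl) (simp add: cv)
    then show ?thesis using that by (simp add: sum.delta)
  qed
  have Q\<omega>: "Q f z \<omega> = 0" for f z
    unfolding Q_def using pm by (intro sum.neutral) (simp add: c\<omega>)
  have Dv: "D z (v s) = (\<Sum>k<N. E (2*k) z *\<^sub>R pdiff s (A k) (C z)) +
      mul \<omega> (\<Sum>k<N. E (2*k+1) z *\<^sub>R pdiff s (B k) (C z))" if "s \<le> p" for z s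
    unfolding D_def using that by (simp add: Qv \<rho>v)
  have D\<omega>: "D z \<omega> = (\<Sum>k<N. E' (2*k) z *\<^sub>R A k (C z)) + mul \<omega> (\<Sum>k<N. E (2*k) z *\<^sub>R B k (C z))" for z
    unfolding D_def by (simp add: Q\<omega> \<rho>\<omega> E'_def)
  show "\<exists>D. (\<forall>z\<in>?S. ((\<lambda>z. CK mul v p m f0 (\<lambda>s. c s z)) has_derivative D z) (at z within ?S)) \<and>
        (\<forall>s\<le>p. continuous_on ?S (\<lambda>z. D z (v s))) \<and>
        continuous_on ?S (\<lambda>z. D z \<omega>) \<and>
        (\<forall>z\<in>?S. (\<Sum>s\<le>p. mul (v s) (D z (v s))) + mul \<omega> (D z \<omega>) = 0)"
  proof (intro exI[of _ D] conjI ballI allI impI)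
    fix z assume z: "z \<in> ?S"
    show "((\<lambda>z. CK mul v p m f0 (\<lambda>s. c s z)) has_derivative D z) (at z within ?S)"
      by (rule has_derivative_transform[OF z CK has_derivative_at_withinI[OF D]])
  next
    fix s assume s: "s \<le> p"
    have "continuous_on UNIV (\<lambda>z. D z (v s))"
      unfolding Dv[OF s] 
      by (intro continuous_on_add bounded_linear.continuous_on[OF blm] continuous_on_sum
          continuous_on_scaleR Ec Qc mpoly_pdiff' A B s)
    then show "continuous_on ?S (\<lambda>z. D z (v s))" by (rule continuous_on_subset) simp
  next
    have "continuous_on UNIV (\<lambda>z. D z \<omega>)"
      unfolding D\<omega>
      by (intro continuous_on_add bounded_linear.continuous_on[OF blm] continuous_on_sum
          continuous_on_scaleR Ec E'c Qc A B)
    then show "continuous_on ?S (\<lambda>z. D z \<omega>)" by (rule continuous_on_subset) simp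
  next
    fix z
    let ?x = "C z"
    \<comment> \<open>The even part yields the terms \<open>B k\<close>, the odd part the terms
      \<open>- A (Suc k)\<close> behind \<omega>. Up to an index shift, the derivative along
      \<omega> yields the same terms with opposite signs.\<close>
    have "(\<Sum>s\<le>p. mul (v s) (D z (v s))) =
        (\<Sum>s\<le>p. \<Sum>k<N. E (2*k) z *\<^sub>R mul (v s) (pdiff s (A k) ?x)) +
        (\<Sum>s\<le>p. \<Sum>k<N. E (2*k+1) z *\<^sub>R mul (v s) (mul \<omega> (pdiff s (B k) ?x)))"
      unfolding sum.distrib[symmetric]
      by (intro sum.cong refl)
        (simp add: Dv linear_add[OF linear_mul] linear_sum[OF linear_mul] linear_cmul[OF linear_mul] sum.distrib)
    also have "(\<Sum>s\<le>p. \<Sum>k<N. E (2*k) z *\<^sub>R mul (v s) (pdiff s (A k) ?x)) = (\<Sum>k<N. E (2*k) z *\<^sub>R B k ?x)"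
      by (subst sum.swap) (simp add: BA dirac_def scaleR_sum_right)
    also have "(\<Sum>s\<le>p. \<Sum>k<N. E (2*k+1) z *\<^sub>R mul (v s) (mul \<omega> (pdiff s (B k) ?x))) =
        (\<Sum>k<N. E (2*k+1) z *\<^sub>R (\<Sum>s\<le>p. mul (v s) (mul \<omega> (pdiff s (B k) ?x))))"
      by (subst sum.swap) (simp add: scaleR_sum_right)
    also have "\<dots> = (\<Sum>k<N. E (2*k+1) z *\<^sub>R mul \<omega> (- A (Suc k) ?x))"
      by (simp only: BA conjugate_dirac_dirac[OF A \<omega>] lapA)
    also have "\<dots> = - mul \<omega> (\<Sum>k<N. E (2*k+1) z *\<^sub>R A (Suc k) ?x)"
      by (simp add: linear_sum[OF linear_mul] mul_simps sum_negf)
    \<comment> \<open>The shift loses nothing at either end: \<open>E' 0\<close> is 0 at the bottom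
      and \<open>A N\<close> is 0 at the top.\<close>
    also have "(\<Sum>k<N. E (2*k+1) z *\<^sub>R A (Suc k) ?x) = (\<Sum>k<N. E' (2*k) z *\<^sub>R A k ?x)"
    proof -
      have "(\<Sum>k<N. E (2*k+1) z *\<^sub>R A (Suc k) ?x) = (\<Sum>k<Suc N. E' (2*k) z *\<^sub>R A k ?x)"
        by (subst sum.lessThan_Suc_shift) (simp add: E'_def)
      then show ?thesis by (simp add: AN)
    qed
    finally show "(\<Sum>s\<le>p. mul (v s) (D z (v s))) + mul \<omega> (D z \<omega>) = 0"
      by (simp add: D\<omega> linear_add[OF linear_mul] mul_sphere_sphere[OF \<omega>])
  qed
qed

end

theorem theorem3p5:
  fixes mul :: "'a::euclidean_space \<Rightarrow> 'a \<Rightarrow> 'a" and e :: 'a and cj :: "'a \<Rightarrow> 'a"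
    and v :: "nat \<Rightarrow> 'a" and m p :: nat and f0 :: "(nat \<Rightarrow> real) \<Rightarrow> 'a"
  assumes alg: "alt_star_algebra mul e cj"
    and dim: "DIM('a) > 1"
    and sph: "sphere_alg mul e cj \<noteq> {}"
    and basis: "admissible_basis mul e cj v m"
    and pm: "p < m"
    and poly: "is_poly p f0"
  shows "(\<exists>N. \<forall>k\<ge>N. \<forall>y. neg_lap_pow p k f0 y = 0 \<and> neg_lap_pow p k (dirac mul v p f0) y = 0)
    \<and> (\<exists>F. gps_monogenic mul v p m F \<and> (\<forall>y. F (\<Sum>s\<le>m. y s *\<^sub>R v s) = CK mul v p m f0 y))
    \<and> (\<forall>y. CK mul v p m f0 (\<lambda>s. if s \<le> p then y s else 0) = f0 y)
    \<and> (\<forall>G. gps_monogenic mul v p m G \<and> (\<forall>y. G (\<Sum>s\<le>p. y s *\<^sub>R v s) = f0 y)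
           \<longrightarrow> (\<forall>y. G (\<Sum>s\<le>m. y s *\<^sub>R v s) = CK mul v p m f0 y))"
proof -
  interpret partial_slice mul e cj v m p
    by unfold_locales (fact alg basis pm)+
  obtain d where f0: "mpoly p d f0" using poly by (rule is_poly_mpoly)
  have dirac0: "mpoly p d (dirac mul v p f0)" by (rule mpoly_dirac[OF bilinear_mul f0])
  obtain c :: "nat \<Rightarrow> 'a \<Rightarrow> real" where c: "\<And>s. linear (c s)" "\<And>s t. s \<le> m \<Longrightarrow> t \<le> m \<Longrightarrow> c s (v t) = (if s = t then 1 else 0)"
    using coordinates by blast
  \<comment> \<open>Since \<open>CK\<close> takes coordinates while monogenicity is about functions
    on the algebra, the coordinates are extended to linear functionals \<open>c\<close> on all of
    it.\<close>
  define F where "F z = CK mul v p m f0 (\<lambda>s. c s z)" for z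
  have F: "gps_monogenic mul v p m F"
    unfolding F_def[abs_def] by (rule CK_monogenic[OF f0 c])
  have cy: "c t (\<Sum>s\<le>m. y s *\<^sub>R v s) = y t" if "t \<le> m" for y t
  proof -
    have "c t (\<Sum>s\<le>m. y s *\<^sub>R v s) = (\<Sum>s\<le>m. y s * c t (v s))"
      by (simp add: linear_sum[OF c(1)] linear_cmul[OF c(1)])
    also have "\<dots> = (\<Sum>s\<le>m. if s = t then y s else 0)"
      using that by (intro sum.cong refl) (auto simp: c(2))
    finally have "c t (\<Sum>s\<le>m. y s *\<^sub>R v s) = \<dots>" .
    then show ?thesis using that by (simp add: sum.delta)
  qed
  \<comment> \<open>The functionals recover a coordinate family only up to index \<open>m\<close>,
    while \<open>y\<close> may be arbitrary beyond it.\<close>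
  have CK_cong: "CK mul v p m f0 y = CK mul v p m f0 y'" if "\<And>s. s \<le> m \<Longrightarrow> y s = y' s" for y y'
  proof -
    have 1: "(\<Sum>s\<in>{p+1..m}. (y s)\<^sup>2) = (\<Sum>s\<in>{p+1..m}. (y' s)\<^sup>2)"
      "(\<Sum>s\<in>{p+1..m}. y s *\<^sub>R v s) = (\<Sum>s\<in>{p+1..m}. y' s *\<^sub>R v s)"
      using that by (auto intro!: sum.cong)
    have 2: "(\<lambda>s. if s \<le> p then y s else 0) = (\<lambda>s. if s \<le> p then y' s else 0)"
      using that pm by auto
    show ?thesis unfolding CK_def 1 2 by (rule refl)
  qed
  have FCK: "F (\<Sum>s\<le>m. y s *\<^sub>R v s) = CK mul v p m f0 y" for y
    unfolding F_def by (rule CK_cong) (rule cy)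
  have CK0: "CK mul v p m f0 (\<lambda>s. if s \<le> p then y s else 0) = f0 y" for y
  proof -
    let ?y = "\<lambda>s. if s \<le> p then y s else 0"
    have "0 = sqrt (\<Sum>s\<in>{p+1..m}. (?y s)\<^sup>2)" by simp
    \<comment> \<open>Truncating at \<open>Suc d\<close> provides a term of index 0 even for
      \<open>d = 0\<close>. With \<open>r = 0\<close> the unit vector degenerates to 0 and only that
      term remains.\<close>
    from CK_eq_finite_sum[OF f0 le_SucI[OF order_refl] this]
    have "CK mul v p m f0 ?y = (\<Sum>k<Suc d. (0 ^ (2*k) / fact (2*k)) *\<^sub>R neg_lap_pow p k f0 ?y)"
      by (simp add: mul_simps)
    also have "\<dots> = f0 ?y"
      by (subst sum.lessThan_Suc_shift) (simp add: neg_lap_pow_0)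
    also have "\<dots> = f0 y" by (rule mpoly_cong[OF f0]) simp
    finally show ?thesis .
  qed
  have split: "(\<Sum>s\<le>m. y s *\<^sub>R v s) = (\<Sum>s\<le>p. y s *\<^sub>R v s) + (\<Sum>s\<in>{p+1..m}. y s *\<^sub>R v s)" for y
  proof -
    have "{..m} = {..p} \<union> {p+1..m}" "{..p} \<inter> {p+1..m} = {}" using pm by auto
    then show ?thesis by (simp add: sum.union_disjoint)
  qed
  have Fp: "F (\<Sum>s\<le>p. y s *\<^sub>R v s) = f0 y" for y
  proof -
    let ?y = "\<lambda>s. if s \<le> p then y s else 0"
    have "(\<Sum>s\<le>m. ?y s *\<^sub>R v s) = (\<Sum>s\<le>p. y s *\<^sub>R v s)" unfolding split by simp
    then show ?thesis using FCK[of ?y] CK0[of y] by simp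
  qed
  have uniq: "G (\<Sum>s\<le>m. y s *\<^sub>R v s) = CK mul v p m f0 y"
    if G: "gps_monogenic mul v p m G" and G0: "\<And>y. G (\<Sum>s\<le>p. y s *\<^sub>R v s) = f0 y" for G y
  proof -
    let ?I = "{p+1..m}"
    define r where "r = sqrt (\<Sum>s\<in>?I. (y s)\<^sup>2)"
    have GF: "G (\<Sum>s\<le>p. y s *\<^sub>R v s) = F (\<Sum>s\<le>p. y s *\<^sub>R v s)" for y
      by (simp only: G0 Fp)
    have "G (\<Sum>s\<le>m. y s *\<^sub>R v s) = F (\<Sum>s\<le>m. y s *\<^sub>R v s)"
    proof (cases "r = 0")
      \<comment> \<open>Here no unit vector can be formed, but the point lies in the initial
        subspace, where the two functions agree by assumption.\<close>
      case True
      then have "\<forall>s\<in>?I. (y s)\<^sup>2 = 0"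
        unfolding r_def by (simp add: sum_nonneg_eq_0_iff)
      then have "(\<Sum>s\<in>?I. y s *\<^sub>R v s) = 0" by (intro sum.neutral) auto
      then show ?thesis using GF[of y] by (simp only: split add_0_right)
    next
      case False
      have "r \<ge> 0" unfolding r_def by (intro real_sqrt_ge_zero sum_nonneg) simp
      with False have r: "r > 0" by simp
      define \<omega> where "\<omega> = (\<Sum>s\<in>?I. (y s / r) *\<^sub>R v s)"
      have "(\<Sum>s\<in>?I. (y s / r)\<^sup>2) = (\<Sum>s\<in>?I. (y s)\<^sup>2) / r\<^sup>2"
        by (simp add: power_divide sum_divide_distrib)
      also have "(\<Sum>s\<in>?I. (y s)\<^sup>2) = r\<^sup>2" unfolding r_def by (simp add: sum_nonneg)
      finally have "(\<Sum>s\<in>?I. (y s / r)\<^sup>2) = 1" using r by simp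
      then have \<omega>: "\<omega> \<in> slice_sphere v p m"
        unfolding slice_sphere_def \<omega>_def by (intro CollectI exI[of _ "\<lambda>s. y s / r"]) simp
      have "(\<Sum>s\<in>?I. y s *\<^sub>R v s) = r *\<^sub>R \<omega>"
        unfolding \<omega>_def using r by (simp add: scaleR_sum_right)
      then show ?thesis
        unfolding split using slice_eq_if_eq_on_real_part[OF G F GF \<omega> r] by (simp only:)
    qed
    then show ?thesis by (simp only: FCK)
  qed
  show ?thesis
    using neg_lap_pow_eq_0[OF f0] neg_lap_pow_eq_0[OF dirac0] F FCK CK0 uniq by blast
qed

end
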